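(* Let $(M,g)$ be a time-oriented $4$-dimensional Lorentzian manifold, and let $\Sigma\subset M$ be a closed spacelike surface. Let $V$ be a smooth (nowhere-vanishing) normal direction along $\Sigma$. Then $$ \delta_{\alpha V}\mathcal E_H(\Sigma)=0\qquad\text{for every }\alpha\in C^\infty(\Sigma) $$ if and only if $\Sigma$ is area-constrained Willmore in the direction $V$ with multiplier $$\lambda=\frac{4\mathcal E_H(\Sigma)}{r_\Sigma^3},$$ where $r_\Sigma:=\sqrt{\frac{|\Sigma|}{4\pi}}$ denotes the area radius of $\Sigma$.
   Context: Conventions. $\langle\cdot,\cdot\rangle=g$ has signature $(-,+,+,+)$, $\nabla$ is its Levi-Civita connection. A spacelike surface $\Sigma$ is a smooth surface with Riemannian induced metric $h$; closed means compact without boundary; $|\Sigma|$ is its area, $d\mu$ its area measure. Mean curvature vector: $\vec H=\operatorname{tr}_h\chi$ where $\chi(X,Y)=-(\nabla_XY)^\perp$; $|\vec H|^2=\langle\vec H,\vec H\rangle$ (which may have any sign). Hawking energy: $\mathcal E_H(\Sigma)=\sqrt{\frac{|\Sigma|}{16\pi}}\left(1-\frac1{16\pi}\int_\Sigma|\vec H|^2\,d\mu\right)$. For a normal field $V$, $\delta_V$ denotes the derivative at time $0$ along a smooth variation of $\Sigma$ with initial velocity $V$. For a nowhere-vanishing normal field $V$, $\Sigma$ is area-constrained Willmore in the direction $V$ if it is critical for $\mathcal W(\Sigma)=\int_\Sigma|\vec H|^2\,d\mu$ under all area-preserving normal variations of the form $\alpha V$, $\alpha\in C^\infty(\Sigma)$;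 it is so with (Lagrange) multiplier $\lambda\in\mathbb R$ if $\delta_{\alpha V}\mathcal W=\lambda\,\delta_{\alpha V}|\Sigma|$ for all $\alpha\in C^\infty(\Sigma)$. *)

theory Defs
  imports "HOL-Analysis.Analysis"
begin

section \<open>Smooth functions on open subsets of normed spaces\<close>

fun Ck_on :: "nat \<Rightarrow> 'a::real_normed_vector set \<Rightarrow> ('a \<Rightarrow> 'b::real_normed_vector) \<Rightarrow> bool" where
  "Ck_on 0 S f \<longleftrightarrow> continuous_on S f"
| "Ck_on (Suc k) S f \<longleftrightarrow>
     (\<forall>x\<in>S. f differentiable (at x)) \<and> (\<forall>v. Ck_on k S (\<lambda>x. frechet_derivative f (at x) v))"

definition smooth_on :: "'a::real_normed_vector set \<Rightarrow> ('a \<Rightarrow> 'b::real_normed_vector) \<Rightarrow> bool" where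
  "smooth_on S f \<longleftrightarrow> (\<forall>k. Ck_on k S f)"


section \<open>Manifolds\<close>

text \<open>
  A manifold is a Hausdorff second countable topological space, given as a type, together with
  a smooth atlas. A chart is a pair of its domain and its coordinate map. Charts have open images,
  so there is no boundary.
\<close>

type_synonym ('a, 'e) chart = "'a set \<times> ('a \<Rightarrow> 'e)"

definition chart_image :: "('a, 'e) chart \<Rightarrow> 'e set" where
  "chart_image c = snd c ` fst c"

definition chart_inv :: "('a, 'e) chart \<Rightarrow> 'e \<Rightarrow> 'a" where
  "chart_inv c = inv_into (fst c) (snd c)"

definition smooth_atlas ::
  "('a::{t2_space, second_countable_topology}, 'e::euclidean_space) chart set \<Rightarrow> bool" where
  "smooth_atlas A \<longleftrightarrow>
     (\<Union>c\<in>A. fst c) = UNIV \<and>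
     (\<forall>c\<in>A. open (fst c) \<and> open (chart_image c) \<and>
        homeomorphism (fst c) (chart_image c) (snd c) (chart_inv c)) \<and>
     (\<forall>c\<in>A. \<forall>d\<in>A. smooth_on (snd c ` (fst c \<inter> fst d)) (snd d \<circ> chart_inv c))"

definition chart_at :: "('a, 'e) chart set \<Rightarrow> 'a \<Rightarrow> ('a, 'e) chart" where
  "chart_at A p = (SOME c. c \<in> A \<and> p \<in> fst c)"

text \<open>
  A tangent vector at \<open>p\<close> is the family of its components in the charts around \<open>p\<close>, related by the
  Jacobians of the coordinate changes. The value at all other charts is fixed to be \<open>0\<close>, so that two
  tangent vectors at \<open>p\<close> are equal iff they have the same components.
\<close>

type_synonym ('a, 'e) tvec = "('a, 'e) chart \<Rightarrow> 'e"

definition tangent_space ::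
  "('a, 'e::euclidean_space) chart set \<Rightarrow> 'a \<Rightarrow> ('a, 'e) tvec set" where
  "tangent_space A p =
     {v. (\<forall>c\<in>A. \<forall>d\<in>A. p \<in> fst c \<longrightarrow> p \<in> fst d \<longrightarrow>
            v d = frechet_derivative (snd d \<circ> chart_inv c) (at (snd c p)) (v c)) \<and>
         (\<forall>c. \<not> (c \<in> A \<and> p \<in> fst c) \<longrightarrow> v c = 0)}"

definition smooth_scalar ::
  "('a, 'e::euclidean_space) chart set \<Rightarrow> ('a \<Rightarrow> real) \<Rightarrow> bool" where
  "smooth_scalar A f \<longleftrightarrow> (\<forall>c\<in>A. smooth_on (chart_image c) (f \<circ> chart_inv c))"

definition smooth_map ::
  "('s::topological_space, 'd::euclidean_space) chart set \<Rightarrow>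
   ('m::topological_space, 'e::euclidean_space) chart set \<Rightarrow> ('s \<Rightarrow> 'm) \<Rightarrow> bool" where
  "smooth_map B A F \<longleftrightarrow> continuous_on UNIV F \<and>
     (\<forall>k\<in>B. \<forall>c\<in>A. smooth_on (snd k ` (fst k \<inter> F -` fst c)) (snd c \<circ> F \<circ> chart_inv k))"

text \<open>
  The differential of \<open>F\<close> at \<open>p\<close>, applied to the vector with components \<open>u\<close> in the chart \<open>k\<close>.
\<close>

definition differential ::
  "('m, 'e::euclidean_space) chart set \<Rightarrow> ('s, 'd::euclidean_space) chart \<Rightarrow> ('s \<Rightarrow> 'm) \<Rightarrow>
   's \<Rightarrow> 'd \<Rightarrow> ('m, 'e) tvec" where
  "differential A k F p u = (\<lambda>c.
     if c \<in> A \<and> F p \<in> fst c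
     then frechet_derivative (snd c \<circ> F \<circ> chart_inv k) (at (snd k p)) u else 0)"

text \<open>Vector fields along a map \<open>F\<close>; vector fields on the manifold are those along the identity.\<close>

definition smooth_field_along ::
  "('s::topological_space, 'd::euclidean_space) chart set \<Rightarrow>
   ('m::topological_space, 'e::euclidean_space) chart set \<Rightarrow>
   ('s \<Rightarrow> 'm) \<Rightarrow> ('s \<Rightarrow> ('m, 'e) tvec) \<Rightarrow> bool" where
  "smooth_field_along B A F X \<longleftrightarrow>
     (\<forall>p. X p \<in> tangent_space A (F p)) \<and>
     (\<forall>k\<in>B. \<forall>c\<in>A. smooth_on (snd k ` (fst k \<inter> F -` fst c)) (\<lambda>x. X (chart_inv k x) c))"


section \<open>Lorentzian metrics\<close>

text \<open>
  A metric is given by its component matrices \<open>G c x\<close> in the charts \<open>c\<close>, as functions of the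
  coordinates \<open>x\<close>.
\<close>

type_synonym 'm metric = "('m, real^4) chart \<Rightarrow> real^4 \<Rightarrow> real^4^4"

definition minkowski :: "real^4^4" where
  "minkowski = (\<chi> i j. if i = j then (if i = 0 then -1 else 1) else 0)"

definition lorentzian_metric :: "('m, real^4) chart set \<Rightarrow> 'm metric \<Rightarrow> bool" where
  "lorentzian_metric A G \<longleftrightarrow>
     (\<forall>c\<in>A. smooth_on (chart_image c) (G c)) \<and>
     (\<forall>c\<in>A. \<forall>x\<in>chart_image c. transpose (G c x) = G c x \<and>
        (\<exists>P. invertible P \<and> transpose P ** G c x ** P = minkowski)) \<and>
     (\<forall>c\<in>A. \<forall>d\<in>A. \<forall>p\<in>fst c \<inter> fst d.
        let J = frechet_derivative (snd d \<circ> chart_inv c) (at (snd c p)) in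
        \<forall>v w. v \<bullet> (G c (snd c p) *v w) = J v \<bullet> (G d (snd d p) *v J w))"

definition metric_inner ::
  "('m, real^4) chart set \<Rightarrow> 'm metric \<Rightarrow> 'm \<Rightarrow>
   ('m, real^4) tvec \<Rightarrow> ('m, real^4) tvec \<Rightarrow> real" where
  "metric_inner A G p v w = (let c = chart_at A p in v c \<bullet> (G c (snd c p) *v w c))"

definition time_orientation ::
  "('m::topological_space, real^4) chart set \<Rightarrow> 'm metric \<Rightarrow>
   ('m \<Rightarrow> ('m, real^4) tvec) \<Rightarrow> bool" where
  "time_orientation A G T \<longleftrightarrow>
     smooth_field_along A A id T \<and> (\<forall>p. metric_inner A G p (T p) (T p) < 0)"

definition metric_deriv ::
  "'m metric \<Rightarrow> ('m, real^4) chart \<Rightarrow> real^4 \<Rightarrow> 4 \<Rightarrow> 4 \<Rightarrow> 4 \<Rightarrow> real" where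
  "metric_deriv G c x e a b = frechet_derivative (\<lambda>y. G c y $ a $ b) (at x) (axis e 1)"

text \<open>
  The coefficient \<open>christoffel G c x a b d\<close> has upper index \<open>a\<close> and lower indices \<open>b\<close>, \<open>d\<close>.
\<close>

definition christoffel ::
  "'m metric \<Rightarrow> ('m, real^4) chart \<Rightarrow> real^4 \<Rightarrow> 4 \<Rightarrow> 4 \<Rightarrow> 4 \<Rightarrow> real" where
  "christoffel G c x a b d =
     (\<Sum>e\<in>UNIV. matrix_inv (G c x) $ a $ e *
        (metric_deriv G c x b e d + metric_deriv G c x d e b - metric_deriv G c x e b d)) / 2"

text \<open>
  The two properties that characterise the Levi-Civita connection.
\<close>

lemma metric_deriv_sym:
  assumes "smooth_atlas A" "lorentzian_metric A G" "c \<in> A" "x \<in> chart_image c"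
  shows "metric_deriv G c x e a b = metric_deriv G c x e b a"
proof -
  have op: "open (chart_image c)" using assms unfolding smooth_atlas_def by blast
  have eq: "G c y $ a $ b = G c y $ b $ a" if "y \<in> chart_image c" for y
  proof -
    have "transpose (G c y) = G c y" using assms that unfolding lorentzian_metric_def by blast
    then have "transpose (G c y) $ a $ b = G c y $ a $ b" by simp
    then show ?thesis by (simp add: transpose_def)
  qed
  have "smooth_on (chart_image c) (G c)" using assms unfolding lorentzian_metric_def by blast
  then have "Ck_on (Suc 0) (chart_image c) (G c)" unfolding smooth_on_def by blast
  then have "G c differentiable (at x)" using assms by simp
  then have "(\<lambda>y. G c y $ a $ b) differentiable (at x)"
    unfolding differentiable_def
    using bounded_linear.has_derivative[OF bounded_linear_vec_nth
        bounded_linear.has_derivative[OF bounded_linear_vec_nth]] by blast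
  then have "frechet_derivative (\<lambda>y. G c y $ a $ b) (at x)
      = frechet_derivative (\<lambda>y. G c y $ b $ a) (at x)"
    by (rule frechet_derivative_transform_within_open[OF _ op assms(4) eq])
  then show ?thesis unfolding metric_deriv_def by simp
qed

lemma christoffel_torsion_free:
  assumes "smooth_atlas A" "lorentzian_metric A G" "c \<in> A" "x \<in> chart_image c"
  shows "christoffel G c x a b d = christoffel G c x a d b"
  unfolding christoffel_def metric_deriv_sym[OF assms, of _ b d] by (simp add: algebra_simps)

lemma christoffel_metric_compatible:
  assumes "smooth_atlas A" "lorentzian_metric A G" "c \<in> A" "x \<in> chart_image c"
  shows "metric_deriv G c x e b d =
    (\<Sum>a\<in>UNIV. christoffel G c x a e b * G c x $ a $ d + christoffel G c x a e d * G c x $ b $ a)"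
proof -
  have sym: "transpose (G c x) = G c x"
    and "\<exists>P. invertible P \<and> transpose P ** G c x ** P = minkowski"
    using assms unfolding lorentzian_metric_def by blast+
  then obtain P where P: "transpose P ** G c x ** P = minkowski" by blast
  have "det minkowski = (\<Prod>i\<in>UNIV. minkowski $ i $ i)"
    by (rule det_diagonal) (simp add: minkowski_def)
  also have "\<dots> \<noteq> 0" by (simp add: minkowski_def)
  finally have "det minkowski \<noteq> 0" .
  then have "det (G c x) \<noteq> 0" unfolding P[symmetric] det_mul by simp
  then have inv: "G c x ** matrix_inv (G c x) = mat 1"
    unfolding invertible_det_nz[symmetric] invertible_def matrix_inv_def
    by (rule conjunct1[OF someI_ex])
  have symc: "G c x $ i $ j = G c x $ j $ i" for i j
    using arg_cong[OF sym, of "\<lambda>M. M $ i $ j"] by (simp add: transpose_def)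
  have lower: "(\<Sum>a\<in>UNIV. christoffel G c x a i j * G c x $ a $ l)
      = (metric_deriv G c x i l j + metric_deriv G c x j l i - metric_deriv G c x l i j) / 2"
    for i j l
  proof -
    define k where
      "k e = metric_deriv G c x i e j + metric_deriv G c x j e i - metric_deriv G c x e i j" for e
    have "(\<Sum>a\<in>UNIV. christoffel G c x a i j * G c x $ a $ l)
      = (\<Sum>a\<in>UNIV. \<Sum>e\<in>UNIV. G c x $ l $ a * matrix_inv (G c x) $ a $ e * k e / 2)"
      unfolding christoffel_def k_def[symmetric]
    proof (rule sum.cong[OF refl])
      fix a
      show "(\<Sum>e\<in>UNIV. matrix_inv (G c x) $ a $ e * k e) / 2 * G c x $ a $ l
        = (\<Sum>e\<in>UNIV. G c x $ l $ a * matrix_inv (G c x) $ a $ e * k e / 2)"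
        unfolding symc[of a l] sum_divide_distrib sum_distrib_right
        by (intro sum.cong refl) simp
    qed
    also have "\<dots> = (\<Sum>e\<in>UNIV. \<Sum>a\<in>UNIV. G c x $ l $ a * matrix_inv (G c x) $ a $ e * k e / 2)"
      by (rule sum.swap)
    also have "\<dots> = (\<Sum>e\<in>UNIV. (G c x ** matrix_inv (G c x)) $ l $ e * k e / 2)"
      by (simp add: matrix_matrix_mult_def sum_distrib_right sum_divide_distrib)
    also have "\<dots> = k l / 2"
      unfolding inv mat_def
      by (simp add: if_distrib if_distribR sum.delta' cong: if_cong)
    finally show ?thesis unfolding k_def .
  qed
  have "(\<Sum>a\<in>UNIV. christoffel G c x a e b * G c x $ a $ d + christoffel G c x a e d * G c x $ b $ a)
      = (\<Sum>a\<in>UNIV. christoffel G c x a e b * G c x $ a $ d)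
        + (\<Sum>a\<in>UNIV. christoffel G c x a e d * G c x $ a $ b)"
    unfolding sum.distrib by (metis symc)
  also have "\<dots> = metric_deriv G c x e b d"
    unfolding lower
    using metric_deriv_sym[OF assms, of e d b] metric_deriv_sym[OF assms, of b d e]
      metric_deriv_sym[OF assms, of d e b] by argo
  finally show ?thesis by simp
qed


section \<open>Spacelike surfaces\<close>

text \<open>
  A surface is given by an embedding \<open>F\<close> of a two-dimensional manifold. For a compact
  source an injective immersion is an embedding, and positive definiteness of the pulled back metric
  implies that \<open>F\<close> is an immersion.
\<close>

definition induced_metric ::
  "('m, real^4) chart set \<Rightarrow> 'm metric \<Rightarrow> ('s, real^2) chart \<Rightarrow> ('s \<Rightarrow> 'm) \<Rightarrow> 's \<Rightarrow> real^2^2" where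
  "induced_metric A G k F p = (\<chi> i j.
     metric_inner A G (F p) (differential A k F p (axis i 1)) (differential A k F p (axis j 1)))"

definition closed_spacelike_surface ::
  "('m::topological_space, real^4) chart set \<Rightarrow> 'm metric \<Rightarrow>
   ('s::{t2_space, second_countable_topology}, real^2) chart set \<Rightarrow> ('s \<Rightarrow> 'm) \<Rightarrow> bool" where
  "closed_spacelike_surface A G B F \<longleftrightarrow>
     smooth_atlas B \<and> compact (UNIV :: 's set) \<and> smooth_map B A F \<and> inj F \<and>
     (\<forall>k\<in>B. \<forall>p\<in>fst k. \<forall>u. u \<noteq> 0 \<longrightarrow> 0 < u \<bullet> (induced_metric A G k F p *v u))"

text \<open>The area measure has density \<open>sqrt (det h)\<close> in every chart.\<close>

definition area_measure ::
  "('m, real^4) chart set \<Rightarrow> 'm metric \<Rightarrow> ('s::topological_space, real^2) chart set \<Rightarrow>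
   ('s \<Rightarrow> 'm) \<Rightarrow> 's measure" where
  "area_measure A G B F = (THE \<mu>. sets \<mu> = sets borel \<and>
     (\<forall>k\<in>B. \<forall>E\<in>sets borel. E \<subseteq> fst k \<longrightarrow>
        emeasure \<mu> E =
          (\<integral>\<^sup>+x\<in>snd k ` E. ennreal (sqrt (det (induced_metric A G k F (chart_inv k x)))) \<partial>lborel)))"

definition area ::
  "('m, real^4) chart set \<Rightarrow> 'm metric \<Rightarrow> ('s::topological_space, real^2) chart set \<Rightarrow>
   ('s \<Rightarrow> 'm) \<Rightarrow> real" where
  "area A G B F = measure (area_measure A G B F) UNIV"

definition area_radius ::
  "('m, real^4) chart set \<Rightarrow> 'm metric \<Rightarrow> ('s::topological_space, real^2) chart set \<Rightarrow>
   ('s \<Rightarrow> 'm) \<Rightarrow> real" where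
  "area_radius A G B F = sqrt (area A G B F / (4 * pi))"

text \<open>
  The covariant derivative, in the direction of the \<open>i\<close>-th coordinate of the chart \<open>k\<close>, of a field
  \<open>Y\<close> along \<open>F\<close> with respect to the Levi-Civita connection.
\<close>

definition cov_deriv ::
  "('m, real^4) chart set \<Rightarrow> 'm metric \<Rightarrow> ('s, real^2) chart \<Rightarrow> ('s \<Rightarrow> 'm) \<Rightarrow> 2 \<Rightarrow>
   ('s \<Rightarrow> ('m, real^4) tvec) \<Rightarrow> 's \<Rightarrow> ('m, real^4) tvec" where
  "cov_deriv A G k F i Y p = (\<lambda>c.
     if c \<in> A \<and> F p \<in> fst c
     then frechet_derivative (\<lambda>x. Y (chart_inv k x) c) (at (snd k p)) (axis i 1)
       + (\<chi> a. \<Sum>b\<in>UNIV. \<Sum>d\<in>UNIV. christoffel G c (snd c (F p)) a b d *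
            differential A k F p (axis i 1) c $ b * Y p c $ d)
     else 0)"

definition normal_space ::
  "('m, real^4) chart set \<Rightarrow> 'm metric \<Rightarrow> ('s, real^2) chart set \<Rightarrow> ('s \<Rightarrow> 'm) \<Rightarrow> 's \<Rightarrow>
   ('m, real^4) tvec set" where
  "normal_space A G B F p =
     {n \<in> tangent_space A (F p). \<forall>k\<in>B. p \<in> fst k \<longrightarrow>
        (\<forall>u. metric_inner A G (F p) n (differential A k F p u) = 0)}"

definition normal_part ::
  "('m, real^4) chart set \<Rightarrow> 'm metric \<Rightarrow> ('s, real^2) chart set \<Rightarrow> ('s \<Rightarrow> 'm) \<Rightarrow> 's \<Rightarrow>
   ('m, real^4) tvec \<Rightarrow> ('m, real^4) tvec" where
  "normal_part A G B F p v = (THE n. n \<in> normal_space A G B F p \<and>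
     (\<exists>u. v = (\<lambda>c. n c + differential A (chart_at B p) F p u c)))"

definition second_fundamental_form ::
  "('m, real^4) chart set \<Rightarrow> 'm metric \<Rightarrow> ('s, real^2) chart set \<Rightarrow> ('s, real^2) chart \<Rightarrow>
   ('s \<Rightarrow> 'm) \<Rightarrow> 's \<Rightarrow> 2 \<Rightarrow> 2 \<Rightarrow> ('m, real^4) tvec" where
  "second_fundamental_form A G B k F p i j = (\<lambda>c.
     - normal_part A G B F p (cov_deriv A G k F i (\<lambda>q. differential A k F q (axis j 1)) p) c)"

definition mean_curvature_vector ::
  "('m, real^4) chart set \<Rightarrow> 'm metric \<Rightarrow> ('s, real^2) chart set \<Rightarrow> ('s \<Rightarrow> 'm) \<Rightarrow> 's \<Rightarrow>
   ('m, real^4) tvec" where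
  "mean_curvature_vector A G B F p = (let k = chart_at B p in
     (\<lambda>c. \<Sum>i\<in>UNIV. \<Sum>j\<in>UNIV. matrix_inv (induced_metric A G k F p) $ i $ j *\<^sub>R
        second_fundamental_form A G B k F p i j c))"

definition willmore ::
  "('m, real^4) chart set \<Rightarrow> 'm metric \<Rightarrow> ('s::topological_space, real^2) chart set \<Rightarrow>
   ('s \<Rightarrow> 'm) \<Rightarrow> real" where
  "willmore A G B F =
     (\<integral>p. (let H = mean_curvature_vector A G B F p in metric_inner A G (F p) H H)
        \<partial>area_measure A G B F)"

definition hawking_energy ::
  "('m, real^4) chart set \<Rightarrow> 'm metric \<Rightarrow> ('s::topological_space, real^2) chart set \<Rightarrow>
   ('s \<Rightarrow> 'm) \<Rightarrow> real" where
  "hawking_energy A G B F =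
     sqrt (area A G B F / (16 * pi)) * (1 - 1 / (16 * pi) * willmore A G B F)"


section \<open>Variations\<close>

definition smooth_normal_direction ::
  "('m::topological_space, real^4) chart set \<Rightarrow> 'm metric \<Rightarrow>
   ('s::topological_space, real^2) chart set \<Rightarrow> ('s \<Rightarrow> 'm) \<Rightarrow>
   ('s \<Rightarrow> ('m, real^4) tvec) \<Rightarrow> bool" where
  "smooth_normal_direction A G B F V \<longleftrightarrow>
     smooth_field_along B A F V \<and> (\<forall>p. V p \<in> normal_space A G B F p) \<and> (\<forall>p. V p \<noteq> (\<lambda>c. 0))"

text \<open>
  By compactness, every smooth family of maps that starts at a closed spacelike surface consists of
  closed spacelike surfaces for small times; requiring it on the time interval only shrinks the
  interval.
\<close>

definition variation ::
  "('m::topological_space, real^4) chart set \<Rightarrow> 'm metric \<Rightarrow>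
   ('s::{t2_space, second_countable_topology}, real^2) chart set \<Rightarrow> ('s \<Rightarrow> 'm) \<Rightarrow>
   ('s \<Rightarrow> ('m, real^4) tvec) \<Rightarrow> (real \<Rightarrow> 's \<Rightarrow> 'm) \<Rightarrow> bool" where
  "variation A G B F V \<Phi> \<longleftrightarrow>
     \<Phi> 0 = F \<and>
     (\<exists>\<epsilon>>0.
        continuous_on ({-\<epsilon><..<\<epsilon>} \<times> UNIV) (\<lambda>(t, p). \<Phi> t p) \<and>
        (\<forall>k\<in>B. \<forall>c\<in>A.
           smooth_on {(t, x). t \<in> {-\<epsilon><..<\<epsilon>} \<and> x \<in> chart_image k \<and> \<Phi> t (chart_inv k x) \<in> fst c}
             (\<lambda>(t, x). snd c (\<Phi> t (chart_inv k x)))) \<and>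
        (\<forall>t\<in>{-\<epsilon><..<\<epsilon>}. closed_spacelike_surface A G B (\<Phi> t))) \<and>
     (\<forall>p. \<forall>c\<in>A. F p \<in> fst c \<longrightarrow>
        ((\<lambda>t. snd c (\<Phi> t p)) has_vector_derivative V p c) (at 0))"

text \<open>
  The first variation of the functional \<open>J\<close> in the direction \<open>V\<close> exists and equals \<open>d\<close>, for all
  choices of the variation with initial velocity \<open>V\<close>.
\<close>

definition has_first_variation ::
  "('m::topological_space, real^4) chart set \<Rightarrow> 'm metric \<Rightarrow>
   ('s::{t2_space, second_countable_topology}, real^2) chart set \<Rightarrow> ('s \<Rightarrow> 'm) \<Rightarrow>
   ('s \<Rightarrow> ('m, real^4) tvec) \<Rightarrow> (('s \<Rightarrow> 'm) \<Rightarrow> real) \<Rightarrow> real \<Rightarrow> bool" where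
  "has_first_variation A G B F V J d \<longleftrightarrow>
     (\<forall>\<Phi>. variation A G B F V \<Phi> \<longrightarrow> ((\<lambda>t. J (\<Phi> t)) has_real_derivative d) (at 0))"

definition scale_field ::
  "('s \<Rightarrow> real) \<Rightarrow> ('s \<Rightarrow> ('m, real^4) tvec) \<Rightarrow> 's \<Rightarrow> ('m, real^4) tvec" where
  "scale_field \<alpha> V = (\<lambda>p c. \<alpha> p *\<^sub>R V p c)"

definition area_constrained_willmore_with_multiplier ::
  "('m::topological_space, real^4) chart set \<Rightarrow> 'm metric \<Rightarrow>
   ('s::{t2_space, second_countable_topology}, real^2) chart set \<Rightarrow> ('s \<Rightarrow> 'm) \<Rightarrow>
   ('s \<Rightarrow> ('m, real^4) tvec) \<Rightarrow> real \<Rightarrow> bool" where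
  "area_constrained_willmore_with_multiplier A G B F V l \<longleftrightarrow>
     (\<forall>\<alpha>. smooth_scalar B \<alpha> \<longrightarrow>
        (\<exists>w a. has_first_variation A G B F (scale_field \<alpha> V) (willmore A G B) w \<and>
               has_first_variation A G B F (scale_field \<alpha> V) (area A G B) a \<and>
               w = l * a))"

end

theory Submission
  imports Defs
begin

text \<open>
  Since the Hawking energy is the explicit function \<open>s (1 - W / (16 \<pi>))\<close> of the Willmore energy \<open>W\<close>
  and of \<open>s = sqrt (\<bar>\<Sigma>\<bar> / (16 \<pi>)) > 0\<close>, it determines \<open>W\<close> once the area is known. Hence only the
  area has to be shown to have a first variation: the Willmore energy of a given variation is then
  differentiable iff the Hawking energy is, and the Hawking energy is stationary iff
  \<open>\<delta> W = E / (2 s^3) \<delta> \<bar>\<Sigma>\<bar>\<close>, where \<open>r = 2 s\<close>.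

  For the area, one cuts the surface into finitely many Borel pieces, each inside a compact subset of a
  chart, and differentiates the integral of the area density over each piece. The derivative depends
  on the variation only through its initial velocity because mixed second derivatives commute.
\<close>

section \<open>Symmetry of second derivatives\<close>

text \<open>The curvature inside \<open>willmore\<close> is never expanded: the two energies are
  compared along one variation at a time, and the number \<open>l * a\<close> found there is common
  to all variations as soon as \<open>a\<close> is. This is why the surface is cut up by means of
  \<open>F\<close> alone, with pieces, charts and the candidate \<open>a\<close> fixed before any
  variation is given.

  Two definitions have to be tamed before anything can be differentiated. The area measure is a
  definite description, so a measure with the prescribed densities must be shown to exist and to be
  unique; it is glued together from the charts, and the change of variables formula makes the local
  prescriptions agree on overlaps. And \<open>metric_inner\<close> reads the metric in a chart
  picked by \<open>SOME\<close>, which may jump from point to point; since differentials and metric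
  transform compatibly, each computation can be moved to one fixed chart of the ambient
  manifold.\<close>

text \<open>Two applications of the mean value theorem, first along \<open>v\<close> and then along
  \<open>w\<close>, turn the second difference into \<open>h^2\<close> times the value of
  \<open>\<lambda>x. g x w\<close> at some point of the parallelogram, and continuity at
  \<open>z\<close> does the rest.\<close>

lemma second_difference_tendsto:
  fixes f :: "'a::real_normed_vector \<Rightarrow> real"
  assumes S: "open S" "z \<in> S"
    and f: "\<And>x. x \<in> S \<Longrightarrow> (f has_derivative f' x) (at x)"
    and g: "\<And>x. x \<in> S \<Longrightarrow> ((\<lambda>x. f' x v) has_derivative g x) (at x)"
    and cont: "continuous (at z) (\<lambda>x. g x w)"
  shows "((\<lambda>h. (f (z + h *\<^sub>R v + h *\<^sub>R w) - f (z + h *\<^sub>R v) - f (z + h *\<^sub>R w) + f z) / h\<^sup>2)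
    \<longlongrightarrow> g z w) (at_right 0)"
proof (rule tendstoI)
  fix e :: real
  assume "e > 0"
  then obtain r1 where r1: "r1 > 0" "\<And>x. dist x z < r1 \<Longrightarrow> dist (g x w) (g z w) < e"
    using cont unfolding continuous_at_eps_delta dist_norm real_norm_def by blast
  obtain r2 where r2: "r2 > 0" "ball z r2 \<subseteq> S"
    using S openE by blast
  define r where "r = min r1 r2"
  \<comment> \<open>Parameters below \<open>d\<close> keep the parallelogram inside the ball of
    radius \<open>r\<close>; the summand 1 covers \<open>v = w = 0\<close>.\<close>
  define d where "d = r / (norm v + norm w + 1)"
  have pos: "norm v + norm w + 1 > 0"
    by (smt (verit) norm_ge_zero)
  have d: "d > 0"
    using r1 r2 pos by (simp add: d_def r_def)
  have near: "dist (z + a *\<^sub>R v + b *\<^sub>R w) z < r"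
    if "0 \<le> a" "a < d" "0 \<le> b" "b < d" for a b
  proof -
    have "dist (z + a *\<^sub>R v + b *\<^sub>R w) z \<le> a * norm v + b * norm w"
      using that norm_triangle_ineq[of "a *\<^sub>R v" "b *\<^sub>R w"] by (simp add: dist_norm algebra_simps)
    also have "\<dots> \<le> d * norm v + d * norm w"
      using that by (intro add_mono mult_right_mono) auto
    also have "\<dots> < d * (norm v + norm w + 1)"
      using d by (simp add: algebra_simps)
    also have "\<dots> = r"
      using pos by (simp add: d_def)
    finally show ?thesis .
  qed
  have inS: "z + a *\<^sub>R v + b *\<^sub>R w \<in> S"
    if "0 \<le> a" "a < d" "0 \<le> b" "b < d" for a b
    using near[OF that] r2 by (auto simp: r_def dist_commute subset_iff)
  have "dist ((f (z + h *\<^sub>R v + h *\<^sub>R w) - f (z + h *\<^sub>R v) - f (z + h *\<^sub>R w) + f z) / h\<^sup>2) (g z w) < e"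
    if h: "0 < h" "h < d" for h
  proof -
    \<comment> \<open>The first mean value theorem is applied to the difference of \<open>f\<close>
      between the two edges parallel to \<open>v\<close>.\<close>
    have "((\<lambda>a. f (z + a *\<^sub>R v + h *\<^sub>R w) - f (z + a *\<^sub>R v)) has_real_derivative
        f' (z + a *\<^sub>R v + h *\<^sub>R w) v - f' (z + a *\<^sub>R v) v) (at a)"
      if "0 \<le> a" "a \<le> h" for a
    proof -
      have D: "((\<lambda>a. f (z + a *\<^sub>R v + b *\<^sub>R w)) has_derivative
          (\<lambda>t. f' (z + a *\<^sub>R v + b *\<^sub>R w) (t *\<^sub>R v))) (at a)" if "0 \<le> b" "b \<le> h" for b
        by (rule has_derivative_compose[where f = "\<lambda>a. z + a *\<^sub>R v + b *\<^sub>R w" and g = f, OF _ f])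
          (use that h \<open>0 \<le> a\<close> \<open>a \<le> h\<close> inS in \<open>auto intro!: derivative_eq_intros\<close>)
      then have "((\<lambda>a. f (z + a *\<^sub>R v + b *\<^sub>R w)) has_real_derivative
          f' (z + a *\<^sub>R v + b *\<^sub>R w) v) (at a)" if "0 \<le> b" "b \<le> h" for b
      proof -
        have "linear (f' (z + a *\<^sub>R v + b *\<^sub>R w))"
          by (rule has_derivative_linear[OF f]) (use that h \<open>0 \<le> a\<close> \<open>a \<le> h\<close> inS in auto)
        then show ?thesis
          using D[of b, OF that]
          by (simp add: has_field_derivative_def linear_cmul mult.commute[of _ "f' _ v"])
      qed
      from DERIV_diff[OF this this, of h 0] h show ?thesis
        by simp
    qed
    then obtain a where a: "0 < a" "a < h"
      and "(f (z + h *\<^sub>R v + h *\<^sub>R w) - f (z + h *\<^sub>R v)) - (f (z + 0 *\<^sub>R v + h *\<^sub>R w) - f (z + 0 *\<^sub>R v))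
        = (h - 0) * (f' (z + a *\<^sub>R v + h *\<^sub>R w) v - f' (z + a *\<^sub>R v) v)"
      using MVT2[OF h(1), of "\<lambda>a. f (z + a *\<^sub>R v + h *\<^sub>R w) - f (z + a *\<^sub>R v)"
        "\<lambda>a. f' (z + a *\<^sub>R v + h *\<^sub>R w) v - f' (z + a *\<^sub>R v) v"] by blast
    then have 1: "f (z + h *\<^sub>R v + h *\<^sub>R w) - f (z + h *\<^sub>R v) - f (z + h *\<^sub>R w) + f z
        = h * (f' (z + a *\<^sub>R v + h *\<^sub>R w) v - f' (z + a *\<^sub>R v) v)"
      by simp
    have "((\<lambda>b. f' (z + a *\<^sub>R v + b *\<^sub>R w) v) has_real_derivative
        g (z + a *\<^sub>R v + b *\<^sub>R w) w) (at b)" if "0 \<le> b" "b \<le> h" for b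
    proof -
      have *: "z + a *\<^sub>R v + b *\<^sub>R w \<in> S"
        by (rule inS) (use that a h in auto)
      have "((\<lambda>b. f' (z + a *\<^sub>R v + b *\<^sub>R w) v) has_derivative
          (\<lambda>t. g (z + a *\<^sub>R v + b *\<^sub>R w) (t *\<^sub>R w))) (at b)"
        by (rule has_derivative_compose[where f = "\<lambda>b. z + a *\<^sub>R v + b *\<^sub>R w"
            and g = "\<lambda>x. f' x v", OF _ g[OF *]])
          (auto intro!: derivative_eq_intros)
      moreover have "linear (g (z + a *\<^sub>R v + b *\<^sub>R w))"
        by (rule has_derivative_linear[OF g[OF *]])
      ultimately show ?thesis
        by (simp add: has_field_derivative_def linear_cmul mult.commute[of _ "g _ w"])
    qed
    then obtain b where b: "0 < b" "b < h"
      and "f' (z + a *\<^sub>R v + h *\<^sub>R w) v - f' (z + a *\<^sub>R v + 0 *\<^sub>R w) v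
        = (h - 0) * g (z + a *\<^sub>R v + b *\<^sub>R w) w"
      using MVT2[OF h(1), of "\<lambda>b. f' (z + a *\<^sub>R v + b *\<^sub>R w) v"
        "\<lambda>b. g (z + a *\<^sub>R v + b *\<^sub>R w) w"] by blast
    with 1 h have "(f (z + h *\<^sub>R v + h *\<^sub>R w) - f (z + h *\<^sub>R v) - f (z + h *\<^sub>R w) + f z) / h\<^sup>2
        = g (z + a *\<^sub>R v + b *\<^sub>R w) w"
      by (simp add: power2_eq_square)
    then show ?thesis
      using r1(2)[of "z + a *\<^sub>R v + b *\<^sub>R w"] near[of a b] a b h by (simp add: r_def)
  qed
  then show "\<forall>\<^sub>F h in at_right 0. dist ((f (z + h *\<^sub>R v + h *\<^sub>R w) - f (z + h *\<^sub>R v)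
      - f (z + h *\<^sub>R w) + f z) / h\<^sup>2) (g z w) < e"
    unfolding eventually_at_right_field using d by blast
qed

lemma frechet_derivative_inner_left:
  assumes "f differentiable (at x)"
  shows "((\<lambda>x. f x \<bullet> b) has_derivative (\<lambda>v. frechet_derivative f (at x) v \<bullet> b)) (at x)"
  using assms by (intro has_derivative_inner_left) (simp add: frechet_derivative_works)

text \<open>The second difference is symmetric in \<open>v\<close> and \<open>w\<close>, so both
  iterated derivatives are limits of the same quotient. Testing against basis vectors reduces to
  real values, as the mean value theorem requires.\<close>

lemma mixed_derivative_swap:
  fixes f :: "'a::real_normed_vector \<Rightarrow> 'b::euclidean_space"
  assumes S: "open S" "z \<in> S" and f: "Ck_on (Suc (Suc 0)) S f"
  shows "frechet_derivative (\<lambda>x. frechet_derivative f (at x) v) (at z) w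
    = frechet_derivative (\<lambda>x. frechet_derivative f (at x) w) (at z) v"
proof (rule euclidean_eqI)
  fix b :: 'b
  have lim: "((\<lambda>h. (f (z + h *\<^sub>R v + h *\<^sub>R w) \<bullet> b - f (z + h *\<^sub>R v) \<bullet> b - f (z + h *\<^sub>R w) \<bullet> b + f z \<bullet> b) / h\<^sup>2)
    \<longlongrightarrow> frechet_derivative (\<lambda>x. frechet_derivative f (at x) v) (at z) w \<bullet> b) (at_right 0)" for v w
  proof (rule second_difference_tendsto[OF S])
    show "((\<lambda>x. f x \<bullet> b) has_derivative (\<lambda>v. frechet_derivative f (at x) v \<bullet> b)) (at x)"
      if "x \<in> S" for x
      using f that by (intro frechet_derivative_inner_left) simp
    show "((\<lambda>x. frechet_derivative f (at x) v \<bullet> b) has_derivative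
        (\<lambda>w. frechet_derivative (\<lambda>x. frechet_derivative f (at x) v) (at x) w \<bullet> b)) (at x)"
      if "x \<in> S" for x
      using f that by (intro frechet_derivative_inner_left) simp
    have "continuous_on S (\<lambda>x. frechet_derivative (\<lambda>x. frechet_derivative f (at x) v) (at x) w)"
      using f by simp
    then show "continuous (at z) (\<lambda>x. frechet_derivative (\<lambda>x. frechet_derivative f (at x) v) (at x) w \<bullet> b)"
      using S by (intro continuous_inner continuous_const) (simp add: continuous_on_eq_continuous_at)
  qed
  show "frechet_derivative (\<lambda>x. frechet_derivative f (at x) v) (at z) w \<bullet> b
    = frechet_derivative (\<lambda>x. frechet_derivative f (at x) w) (at z) v \<bullet> b"
    by (rule tendsto_unique[OF _ lim]) (use lim[of w v] in \<open>simp_all add: algebra_simps\<close>)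
qed

section \<open>Change of variables for nonnegative functions\<close>

text \<open>The area measure is prescribed through \<open>nn_integral\<close>, whereas the change of
  variables speaks of gauge integrals with a separate notion of integrability. For nonnegative
  functions the two agree, with infinity standing for failure of integrability.\<close>

lemma nn_integral_eq_integral_or_top:
  fixes h :: "'a::euclidean_space \<Rightarrow> real"
  assumes S: "S \<in> sets borel" and h0: "\<And>x. x \<in> S \<Longrightarrow> 0 \<le> h x"
    and m: "h \<in> borel_measurable (restrict_space borel S)"
  shows "(\<integral>\<^sup>+x\<in>S. ennreal (h x) \<partial>lborel)
    = (if h integrable_on S then ennreal (integral S h) else \<infinity>)"
proof -
  have m': "(\<lambda>x. indicator S x *\<^sub>R h x) \<in> borel_measurable borel"
    using m S by (simp add: borel_measurable_restrict_space_iff)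
  show ?thesis
  proof (cases "h integrable_on S")
    case True
    then show ?thesis
      using nn_integral_has_integral_lebesgue'[OF h0 integrable_integral[OF True]] by simp
  next
    case False
    have eq: "(\<integral>\<^sup>+x\<in>S. ennreal (h x) \<partial>lborel) = (\<integral>\<^sup>+x. ennreal (indicator S x *\<^sub>R h x) \<partial>lborel)"
      by (intro nn_integral_cong) (auto simp: indicator_def)
    have "(\<integral>\<^sup>+x\<in>S. ennreal (h x) \<partial>lborel) = \<infinity>"
    proof (rule ccontr)
      assume "(\<integral>\<^sup>+x\<in>S. ennreal (h x) \<partial>lborel) \<noteq> \<infinity>"
      then have "integrable lborel (\<lambda>x. indicator S x *\<^sub>R h x)"
        unfolding eq using m' h0
        by (intro integrableI_nonneg) (auto simp: indicator_def less_top)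
      then have "(\<lambda>x. indicator S x *\<^sub>R h x) integrable_on UNIV"
        by (rule integrable_on_lborel)
      then have "h integrable_on S"
        by (simp only: indicator_scaleR_eq_if integrable_restrict_UNIV)
      with False show False by simp
    qed
    with False show ?thesis by simp
  qed
qed

text \<open>The equality must also hold when both sides are infinite. It is therefore drawn from an
  equivalence about integrability and value together, available for every candidate value
  \<open>b\<close>.\<close>

lemma nn_integral_change_of_variables:
  fixes g :: "real^'n::{finite,wellorder} \<Rightarrow> real^'n::_"
  assumes S: "S \<in> sets borel" "g ` S \<in> sets borel"
    and g: "\<And>x. x \<in> S \<Longrightarrow> (g has_derivative g' x) (at x within S)" "inj_on g S"
    and R: "\<And>y. y \<in> g ` S \<Longrightarrow> 0 \<le> R y" "R \<in> borel_measurable (restrict_space borel (g ` S))"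
    and Q: "\<And>x. x \<in> S \<Longrightarrow> Q x = \<bar>det (matrix (g' x))\<bar> * R (g x)"
      "Q \<in> borel_measurable (restrict_space borel S)"
  shows "(\<integral>\<^sup>+x\<in>S. ennreal (Q x) \<partial>lborel) = (\<integral>\<^sup>+y\<in>g ` S. ennreal (R y) \<partial>lborel)"
proof -
  have Q0: "0 \<le> Q x" if "x \<in> S" for x
    using that R(1) Q(1) by simp
  have "S \<in> sets lebesgue"
    using S by simp
  \<comment> \<open>The formula is for vector-valued integrands; a real one is treated as a vector
    of length 1.\<close>
  from has_absolute_integral_change_of_variables[OF this g, of "\<lambda>y. (vec (R y) :: real^1)" "vec b" for b]
  have *: "(\<lambda>x. \<bar>det (matrix (g' x))\<bar> * R (g x)) absolutely_integrable_on S \<and>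
      integral S (\<lambda>x. \<bar>det (matrix (g' x))\<bar> * R (g x)) = b
     \<longleftrightarrow> R absolutely_integrable_on (g ` S) \<and> integral (g ` S) R = b" for b
    unfolding absolutely_integrable_on_1_iff integral_on_1_eq by (simp add: vec_eq_iff)
  have **: "Q integrable_on S \<and> integral S Q = b \<longleftrightarrow> R integrable_on (g ` S) \<and> integral (g ` S) R = b" for b
  proof -
    have "Q integrable_on S \<longleftrightarrow> (\<lambda>x. \<bar>det (matrix (g' x))\<bar> * R (g x)) integrable_on S"
      by (rule integrable_cong) (simp add: Q(1))
    moreover have "integral S Q = integral S (\<lambda>x. \<bar>det (matrix (g' x))\<bar> * R (g x))"
      by (rule integral_cong) (simp add: Q(1))
    ultimately show ?thesis
      using *[of b] R(1) by (simp add: absolutely_integrable_on_iff_nonneg)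
  qed
  \<comment> \<open>Taking for \<open>b\<close> each of the two actual integrals yields both
    directions and the equality.\<close>
  have "Q integrable_on S \<longleftrightarrow> R integrable_on (g ` S)"
    using **[of "integral S Q"] **[of "integral (g ` S) R"] by argo
  moreover have "integral S Q = integral (g ` S) R" if "Q integrable_on S"
    using **[of "integral S Q"] that by argo
  moreover have "(\<integral>\<^sup>+x\<in>S. ennreal (Q x) \<partial>lborel)
      = (if Q integrable_on S then ennreal (integral S Q) else \<infinity>)"
    by (rule nn_integral_eq_integral_or_top[OF S(1) Q0 Q(2)])
  moreover have "(\<integral>\<^sup>+y\<in>g ` S. ennreal (R y) \<partial>lborel)
      = (if R integrable_on g ` S then ennreal (integral (g ` S) R) else \<infinity>)"
    by (rule nn_integral_eq_integral_or_top[OF S(2) R])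
  ultimately show ?thesis
    by simp
qed

section \<open>Measures with given densities in the charts\<close>

lemma smooth_atlasD:
  assumes "smooth_atlas A" "c \<in> A"
  shows open_chart_domain: "open (fst c)"
    and open_chart_image: "open (chart_image c)"
    and chart_homeomorphism: "homeomorphism (fst c) (chart_image c) (snd c) (chart_inv c)"
  using assms unfolding smooth_atlas_def by auto

lemma smooth_atlas_cover: "smooth_atlas A \<Longrightarrow> \<exists>c\<in>A. p \<in> fst c"
  unfolding smooth_atlas_def by blast

lemma chart_at_mem:
  assumes "smooth_atlas A"
  shows "chart_at A p \<in> A" "p \<in> fst (chart_at A p)"
proof -
  have "\<exists>c. c \<in> A \<and> p \<in> fst c"
    using smooth_atlas_cover[OF assms] by blast
  from someI_ex[OF this] show "chart_at A p \<in> A" "p \<in> fst (chart_at A p)"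
    unfolding chart_at_def by auto
qed

context
  fixes A :: "('a::{t2_space, second_countable_topology}, 'e::euclidean_space) chart set"
    and c :: "('a, 'e) chart"
  assumes A: "smooth_atlas A" and c: "c \<in> A"
begin

lemma chart_inv_chart: "p \<in> fst c \<Longrightarrow> chart_inv c (snd c p) = p"
  using chart_homeomorphism[OF A c] by (auto simp: homeomorphism_def)

lemma chart_chart_inv: "x \<in> chart_image c \<Longrightarrow> snd c (chart_inv c x) = x"
  using chart_homeomorphism[OF A c] by (auto simp: homeomorphism_def)

lemma chart_inv_mem: "x \<in> chart_image c \<Longrightarrow> chart_inv c x \<in> fst c"
  using chart_homeomorphism[OF A c] by (auto simp: homeomorphism_def)

lemma chart_mem: "p \<in> fst c \<Longrightarrow> snd c p \<in> chart_image c"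
  by (simp add: chart_image_def)

lemma continuous_on_chart: "continuous_on (fst c) (snd c)"
  using chart_homeomorphism[OF A c] by (auto simp: homeomorphism_def)

lemma continuous_on_chart_inv: "continuous_on (chart_image c) (chart_inv c)"
  using chart_homeomorphism[OF A c] by (auto simp: homeomorphism_def)

lemma inj_on_chart: "inj_on (snd c) (fst c)"
  by (metis chart_inv_chart inj_onI)

text \<open>Images under a chart become preimages under \<open>chart_inv\<close>, whose continuity
  and measurability then show that open sets have open images and Borel sets have Borel
  images.\<close>

lemma chart_image_eq_vimage:
  "U \<subseteq> fst c \<Longrightarrow> snd c ` U = chart_inv c -` U \<inter> chart_image c"
  using chart_inv_chart chart_chart_inv chart_mem by force

lemma open_chart_subset: "open U \<Longrightarrow> U \<subseteq> fst c \<Longrightarrow> open (snd c ` U)"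
  unfolding chart_image_eq_vimage
  using continuous_on_chart_inv open_chart_image[OF A c] by (simp add: continuous_on_open_vimage)

lemma borel_chart_subset:
  assumes "U \<in> sets borel" "U \<subseteq> fst c"
  shows "snd c ` U \<in> sets borel"
proof -
  have "chart_inv c \<in> borel_measurable (restrict_space borel (chart_image c))"
    using continuous_on_chart_inv by (rule borel_measurable_continuous_on_restrict)
  then have "chart_inv c -` U \<inter> space (restrict_space borel (chart_image c))
      \<in> sets (restrict_space borel (chart_image c))"
    using assms(1) by (rule measurable_sets)
  then show ?thesis
    using open_chart_image[OF A c] chart_image_eq_vimage[OF assms(2)]
    by (auto simp: space_restrict_space sets_restrict_space_iff)
qed

lemma transition_differentiable:
  assumes "d \<in> A" "p \<in> fst c" "p \<in> fst d"
  shows "(snd d \<circ> chart_inv c) differentiable (at (snd c p))"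
proof -
  have "smooth_on (snd c ` (fst c \<inter> fst d)) (snd d \<circ> chart_inv c)"
    using A c assms unfolding smooth_atlas_def by blast
  then have "Ck_on (Suc 0) (snd c ` (fst c \<inter> fst d)) (snd d \<circ> chart_inv c)"
    unfolding smooth_on_def by blast
  then show ?thesis
    using assms by simp
qed

end

section \<open>Cutting a compact space into Borel pieces\<close>

lemma disjoint_family_on_image:
  assumes "inj_on f C" "disjoint_family_on X I" "\<And>i. i \<in> I \<Longrightarrow> X i \<subseteq> C"
  shows "disjoint_family_on (\<lambda>i. f ` X i) I"
  unfolding disjoint_family_on_def
proof (intro ballI impI)
  fix i j assume ij: "i \<in> I" "j \<in> I" "i \<noteq> j"
  then have "f ` X i \<inter> f ` X j = f ` (X i \<inter> X j)"
    using assms(1,3) by (intro inj_on_image_Int[symmetric]) auto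
  then show "f ` X i \<inter> f ` X j = {}"
    using assms(2) ij by (simp add: disjoint_family_on_def)
qed

text \<open>A finite subcover made disjoint. It takes the place of a partition of unity: questions
  about the whole surface are reduced to sets inside one chart.\<close>

lemma finite_borel_partition:
  fixes U :: "'a::t2_space \<Rightarrow> 'a set"
  assumes "compact (UNIV :: 'a set)" "\<And>p. open (U p)" "\<And>p. p \<in> U p"
  obtains P E where "finite P" "\<And>p. p \<in> P \<Longrightarrow> E p \<in> sets borel" "\<And>p. p \<in> P \<Longrightarrow> E p \<subseteq> U p"
    "disjoint_family_on E P" "(\<Union>p\<in>P. E p) = UNIV"
proof -
  obtain P where P: "finite P" "UNIV \<subseteq> (\<Union>p\<in>P. U p)"
    by (rule compactE_image[OF assms(1), of UNIV U]) (use assms in auto)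
  have "\<exists>E. (\<forall>p\<in>P. E p \<in> sets borel \<and> E p \<subseteq> U p) \<and> disjoint_family_on E P
      \<and> (\<Union>p\<in>P. E p) = (\<Union>p\<in>P. U p)"
    using P(1)
  proof induction
    case empty
    then show ?case by (simp add: disjoint_family_on_def)
  next
    case (insert q P)
    then obtain E where E: "\<forall>p\<in>P. E p \<in> sets borel \<and> E p \<subseteq> U p" "disjoint_family_on E P"
      "(\<Union>p\<in>P. E p) = (\<Union>p\<in>P. U p)"
      by blast
    \<comment> \<open>The new piece is what the earlier open sets leave uncovered, hence disjoint
      from the earlier pieces, which stay as they are.\<close>
    define E' where "E' = E(q := U q - (\<Union>p\<in>P. U p))"
    have eq: "E' p = E p" if "p \<in> P" for p
      using that insert.hyps by (auto simp: E'_def)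
    have q: "E' q = U q - (\<Union>p\<in>P. U p)"
      by (simp add: E'_def)
    have "(\<Union>p\<in>P. E' p) = (\<Union>p\<in>P. U p)"
      using E(3) eq by simp
    then have "(\<Union>p\<in>insert q P. E' p) = (\<Union>p\<in>insert q P. U p)"
      using q by auto
    moreover have "disjoint_family_on E' (insert q P)"
      unfolding disjoint_family_on_def
    proof (intro ballI impI)
      fix a b assume ab: "a \<in> insert q P" "b \<in> insert q P" "a \<noteq> b"
      show "E' a \<inter> E' b = {}"
      proof (cases "a = q \<or> b = q")
        case True
        then show ?thesis
          using ab q eq E(1) by (auto) blast+
      next
        case False
        then show ?thesis
          using ab eq E(2) by (auto simp: disjoint_family_on_def)
      qed
    qed
    moreover have "E' p \<in> sets borel \<and> E' p \<subseteq> U p" if "p \<in> insert q P" for p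
    proof (cases "p = q")
      case True
      have "U q - (\<Union>p\<in>P. U p) \<in> sets borel"
        using assms(2) by (intro sets.Diff borel_open open_UN) auto
      then show ?thesis
        using True q by auto
    next
      case False
      then show ?thesis
        using that eq E(1) by auto
    qed
    ultimately show ?case
      by blast
  qed
  then obtain E where E: "\<forall>p\<in>P. E p \<in> sets borel \<and> E p \<subseteq> U p" "disjoint_family_on E P"
    "(\<Union>p\<in>P. E p) = (\<Union>p\<in>P. U p)"
    by blast
  show ?thesis
    by (rule that[of P E]) (use E P in auto)
qed

section \<open>Gluing chart densities to one measure\<close>

text \<open>A positive continuous density in the sense of differential geometry: the coefficients
  transform by the absolute Jacobian determinant, so no orientation is involved.\<close>

definition density_family ::
  "('s::topological_space, real^'n) chart set \<Rightarrow> (('s, real^'n) chart \<Rightarrow> real^'n \<Rightarrow> real) \<Rightarrow> bool" where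
  "density_family B R \<longleftrightarrow>
     (\<forall>k\<in>B. continuous_on (chart_image k) (R k) \<and> (\<forall>x\<in>chart_image k. 0 < R k x)) \<and>
     (\<forall>k\<in>B. \<forall>l\<in>B. \<forall>p\<in>fst k \<inter> fst l. R k (snd k p) =
        \<bar>det (matrix (frechet_derivative (snd l \<circ> chart_inv k) (at (snd k p))))\<bar> * R l (snd l p))"

text \<open>For \<open>R = area_density A G F\<close> this is the predicate under the
  \<open>THE\<close> of \<open>area_measure\<close>.\<close>

definition has_chart_densities ::
  "('s::topological_space, real^'n) chart set \<Rightarrow> (('s, real^'n) chart \<Rightarrow> real^'n \<Rightarrow> real) \<Rightarrow>
   's measure \<Rightarrow> bool" where
  "has_chart_densities B R \<mu> \<longleftrightarrow> sets \<mu> = sets borel \<and>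
     (\<forall>k\<in>B. \<forall>E\<in>sets borel. E \<subseteq> fst k \<longrightarrow>
        emeasure \<mu> E = (\<integral>\<^sup>+x\<in>snd k ` E. ennreal (R k x) \<partial>lborel))"

context
  fixes B :: "('s::{t2_space, second_countable_topology}, real^'n::{finite, wellorder}) chart set"
    and R :: "('s, real^'n::_) chart \<Rightarrow> real^'n::_ \<Rightarrow> real"
  assumes B: "smooth_atlas B" and R: "density_family B R"
begin

lemma density_measurable:
  assumes "k \<in> B" "U \<subseteq> chart_image k"
  shows "R k \<in> borel_measurable (restrict_space borel U)"
proof (rule borel_measurable_continuous_on_restrict)
  show "continuous_on U (R k)"
    using R assms unfolding density_family_def by (blast intro: continuous_on_subset)
qed

text \<open>The transformation law of \<open>R\<close> is the Jacobian factor in the substitution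
  along the transition map \<open>g\<close>, so the value prescribed for a set inside two charts is
  the same for both.\<close>

lemma density_change_of_chart:
  assumes k: "k \<in> B" and l: "l \<in> B" and E: "E \<in> sets borel" "E \<subseteq> fst k" "E \<subseteq> fst l"
  shows "(\<integral>\<^sup>+x\<in>snd k ` E. ennreal (R k x) \<partial>lborel) = (\<integral>\<^sup>+x\<in>snd l ` E. ennreal (R l x) \<partial>lborel)"
proof -
  define g where "g = snd l \<circ> chart_inv k"
  have g: "g (snd k p) = snd l p" if "p \<in> E" for p
    using that E chart_inv_chart[OF B k] by (auto simp: g_def)
  then have im: "g ` snd k ` E = snd l ` E"
    by (auto simp: image_iff)
  have "(\<integral>\<^sup>+x\<in>snd k ` E. ennreal (R k x) \<partial>lborel) = (\<integral>\<^sup>+x\<in>g ` snd k ` E. ennreal (R l x) \<partial>lborel)"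
  proof (rule nn_integral_change_of_variables[where g' = "\<lambda>x. frechet_derivative g (at x)"])
    show "snd k ` E \<in> sets borel" "g ` snd k ` E \<in> sets borel"
      using borel_chart_subset[OF B k] borel_chart_subset[OF B l] E im by auto
    show "(g has_derivative frechet_derivative g (at x)) (at x within snd k ` E)"
      if "x \<in> snd k ` E" for x
    proof (rule has_derivative_at_withinI)
      have "g differentiable (at x)"
        using transition_differentiable[OF B k l] that E unfolding g_def by auto
      then show "(g has_derivative frechet_derivative g (at x)) (at x)"
        by (simp only: frechet_derivative_works)
    qed
    show "inj_on g (snd k ` E)"
    proof (rule inj_onI)
      fix x y assume "x \<in> snd k ` E" "y \<in> snd k ` E" "g x = g y"
      then obtain p q where pq: "p \<in> E" "q \<in> E" "x = snd k p" "y = snd k q" "snd l p = snd l q"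
        using g by auto
      then have "p = q"
        using inj_on_chart[OF B l] E(3) by (meson inj_onD subsetD)
      then show "x = y"
        using pq by simp
    qed
    show "0 \<le> R l y" if "y \<in> g ` snd k ` E" for y
      using that R l E unfolding im density_family_def
      by (auto intro!: less_imp_le simp: chart_image_def)
    show "R l \<in> borel_measurable (restrict_space borel (g ` snd k ` E))"
      "R k \<in> borel_measurable (restrict_space borel (snd k ` E))"
      unfolding im using E
      by (auto intro!: density_measurable k l simp: chart_image_def)
    show "R k x = \<bar>det (matrix (frechet_derivative g (at x)))\<bar> * R l (g x)"
      if x: "x \<in> snd k ` E" for x
    proof -
      obtain p where p: "p \<in> E" "x = snd k p"
        using x by blast
      then have "p \<in> fst k \<inter> fst l"
        using E by auto
      then have "R k (snd k p) = \<bar>det (matrix (frechet_derivative g (at (snd k p))))\<bar> * R l (snd l p)"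
        using R k l unfolding density_family_def g_def by blast
      then show ?thesis
        using p g by simp
    qed
  qed
  then show ?thesis
    unfolding im .
qed

text \<open>The values are fixed on sets inside one chart, and a finite Borel partition cuts every
  Borel set into such sets.\<close>

lemma has_chart_densities_unique:
  assumes "compact (UNIV :: 's set)" and \<mu>: "has_chart_densities B R \<mu>" and \<nu>: "has_chart_densities B R \<nu>"
  shows "\<mu> = \<nu>"
proof (rule measure_eqI)
  have s: "sets \<mu> = sets borel" "sets \<nu> = sets borel"
    using \<mu> \<nu> by (auto simp: has_chart_densities_def)
  then show "sets \<mu> = sets \<nu>" by simp
  obtain P E where P: "finite P" "\<And>p. p \<in> P \<Longrightarrow> E p \<in> sets borel"
    "\<And>p. p \<in> P \<Longrightarrow> E p \<subseteq> fst (chart_at B p)" "disjoint_family_on E P" "(\<Union>p\<in>P. E p) = UNIV"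
    by (rule finite_borel_partition[OF assms(1), of "\<lambda>p. fst (chart_at B p)"])
      (use chart_at_mem[OF B] open_chart_domain[OF B] in auto)
  fix X assume "X \<in> sets \<mu>"
  then have X: "X \<in> sets borel"
    using s by simp
  have split: "emeasure M X = (\<Sum>p\<in>P. emeasure M (X \<inter> E p))" if "sets M = sets borel" for M
  proof -
    have "X = (\<Union>p\<in>P. X \<inter> E p)"
      using P(5) by blast
    then show ?thesis
      using P X that
      by (subst sum_emeasure) (auto intro!: disjoint_family_on_bisimulation[OF P(4)])
  qed
  have "emeasure \<mu> (X \<inter> E p) = emeasure \<nu> (X \<inter> E p)" if "p \<in> P" for p
  proof -
    have "X \<inter> E p \<in> sets borel" "X \<inter> E p \<subseteq> fst (chart_at B p)"
      using X P(2,3)[OF that] by auto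
    then show ?thesis
      using \<mu> \<nu> chart_at_mem(1)[OF B, of p] unfolding has_chart_densities_def by simp
  qed
  then show "emeasure \<mu> X = emeasure \<nu> X"
    using split s by simp
qed

text \<open>Each piece of a Borel partition carries the density of its own chart, and the measure is
  the sum over the pieces. For a set inside another chart \<open>k\<close>, the chart can be
  exchanged on each piece separately.\<close>

lemma has_chart_densities_exists:
  assumes "compact (UNIV :: 's set)"
  shows "\<exists>\<mu>. has_chart_densities B R \<mu>"
proof -
  obtain P E where P: "finite P" "\<And>p. p \<in> P \<Longrightarrow> E p \<in> sets borel"
    "\<And>p. p \<in> P \<Longrightarrow> E p \<subseteq> fst (chart_at B p)" "disjoint_family_on E P" "(\<Union>p\<in>P. E p) = UNIV"
    by (rule finite_borel_partition[OF assms(1), of "\<lambda>p. fst (chart_at B p)"])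
      (use chart_at_mem[OF B] open_chart_domain[OF B] in auto)
  \<comment> \<open>\<open>R k\<close> is controlled on the chart image only; the indicator makes
    the density measurable everywhere.\<close>
  define D where "D k = density lborel (\<lambda>x. ennreal (R k x) * indicator (chart_image k) x)" for k
  have sets_D: "sets (D k) = sets borel" for k
    by (simp add: D_def)
  have D: "emeasure (D k) Y = (\<integral>\<^sup>+x\<in>Y. ennreal (R k x) \<partial>lborel)"
    if "k \<in> B" "Y \<in> sets borel" "Y \<subseteq> chart_image k" for k Y
  proof -
    have "(\<lambda>x. ennreal (R k x)) \<in> borel_measurable (restrict_space borel (chart_image k))"
      using density_measurable[OF that(1) order.refl] by measurable
    then have "(\<lambda>x. ennreal (R k x) * indicator (chart_image k) x) \<in> borel_measurable borel"
      using open_chart_image[OF B that(1)]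
      by (subst (asm) borel_measurable_restrict_space_iff_ennreal) auto
    then have "emeasure (D k) Y
        = (\<integral>\<^sup>+x. ennreal (R k x) * indicator (chart_image k) x * indicator Y x \<partial>lborel)"
      unfolding D_def using that by (subst emeasure_density) auto
    also have "\<dots> = (\<integral>\<^sup>+x\<in>Y. ennreal (R k x) \<partial>lborel)"
      using that by (intro nn_integral_cong) (auto simp: indicator_def)
    finally show ?thesis .
  qed
  \<comment> \<open>The chart is injective on \<open>E p\<close>, so carrying sets forward by it
    preserves disjoint unions; this is the source of countable additivity.\<close>
  define \<nu> where "\<nu> p X = emeasure (D (chart_at B p)) (snd (chart_at B p) ` (X \<inter> E p))" for p X
  define \<mu> where "\<mu> = measure_of UNIV (sets borel) (\<lambda>X. \<Sum>p\<in>P. \<nu> p X)"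
  have sets_\<mu>: "sets \<mu> = sets borel"
    using sets.sigma_sets_eq[of "borel :: 's measure"] by (simp add: \<mu>_def)
  have add: "(\<Sum>i. \<nu> p (X i)) = \<nu> p (\<Union>i. X i)"
    if p: "p \<in> P" and X: "range X \<subseteq> sets borel" "disjoint_family X" for p and X :: "nat \<Rightarrow> 's set"
  proof -
    define Y where "Y i = snd (chart_at B p) ` (X i \<inter> E p)" for i
    have "Y i \<in> sets borel" for i
      unfolding Y_def
    proof (rule borel_chart_subset[OF B chart_at_mem(1)[OF B]])
      show "X i \<inter> E p \<in> sets borel" "X i \<inter> E p \<subseteq> fst (chart_at B p)"
        using X(1) P(2,3)[OF p] by auto
    qed
    then have "range Y \<subseteq> sets (D (chart_at B p))"
      unfolding sets_D by blast
    moreover have "disjoint_family Y"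
      unfolding Y_def
    proof (rule disjoint_family_on_image[OF inj_on_chart[OF B chart_at_mem(1)[OF B]]])
      show "disjoint_family (\<lambda>i. X i \<inter> E p)"
        by (rule disjoint_family_on_bisimulation[OF X(2)]) auto
      show "X i \<inter> E p \<subseteq> fst (chart_at B p)" for i
        using P(3)[OF p] by auto
    qed
    moreover have "(\<Union>i. Y i) = snd (chart_at B p) ` ((\<Union>i. X i) \<inter> E p)"
      unfolding Y_def by blast
    ultimately show ?thesis
      using suminf_emeasure[of Y "D (chart_at B p)"] by (simp add: \<nu>_def Y_def)
  qed
  have em: "emeasure \<mu> X = (\<Sum>p\<in>P. \<nu> p X)" if "X \<in> sets borel" for X
  proof (rule emeasure_measure_of[OF \<mu>_def])
    show "positive (sets \<mu>) (\<lambda>X. \<Sum>p\<in>P. \<nu> p X)"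
      by (simp add: positive_def \<nu>_def)
    show "countably_additive (sets \<mu>) (\<lambda>X. \<Sum>p\<in>P. \<nu> p X)"
      unfolding countably_additive_def sets_\<mu>
      using add by (auto simp: suminf_sum)
  qed (use that sets_\<mu> in auto)
  have "emeasure \<mu> X = (\<integral>\<^sup>+x\<in>snd k ` X. ennreal (R k x) \<partial>lborel)"
    if k: "k \<in> B" and X: "X \<in> sets borel" "X \<subseteq> fst k" for k X
  proof -
    have sub: "X \<inter> E p \<in> sets borel" "X \<inter> E p \<subseteq> fst k" "X \<inter> E p \<subseteq> fst (chart_at B p)"
      if "p \<in> P" for p
      using X P(2,3)[OF that] by auto
    have "\<nu> p X = emeasure (D k) (snd k ` (X \<inter> E p))" if "p \<in> P" for p
    proof -
      have "\<nu> p X = (\<integral>\<^sup>+x\<in>snd (chart_at B p) ` (X \<inter> E p). ennreal (R (chart_at B p) x) \<partial>lborel)"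
        unfolding \<nu>_def using sub[OF that] chart_at_mem(1)[OF B]
        by (intro D borel_chart_subset[OF B]) (auto simp: chart_image_def)
      also have "\<dots> = (\<integral>\<^sup>+x\<in>snd k ` (X \<inter> E p). ennreal (R k x) \<partial>lborel)"
        using sub[OF that] by (intro density_change_of_chart chart_at_mem(1)[OF B] k)
      also have "\<dots> = emeasure (D k) (snd k ` (X \<inter> E p))"
        using sub[OF that] k
        by (intro D[symmetric] borel_chart_subset[OF B]) (auto simp: chart_image_def)
      finally show ?thesis .
    qed
    then have "emeasure \<mu> X = (\<Sum>p\<in>P. emeasure (D k) (snd k ` (X \<inter> E p)))"
      using em[OF X(1)] by simp
    also have "\<dots> = emeasure (D k) (\<Union>p\<in>P. snd k ` (X \<inter> E p))"
    proof (rule sum_emeasure)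
      show "(\<lambda>p. snd k ` (X \<inter> E p)) ` P \<subseteq> sets (D k)"
        using sub borel_chart_subset[OF B k] by (auto simp: sets_D)
      show "disjoint_family_on (\<lambda>p. snd k ` (X \<inter> E p)) P"
      proof (rule disjoint_family_on_image[OF inj_on_chart[OF B k]])
        show "disjoint_family_on (\<lambda>p. X \<inter> E p) P"
          by (rule disjoint_family_on_bisimulation[OF P(4)]) auto
      qed (use X(2) in auto)
    qed (rule P(1))
    also have "(\<Union>p\<in>P. snd k ` (X \<inter> E p)) = snd k ` X"
      using P(5) by blast
    also have "emeasure (D k) (snd k ` X) = (\<integral>\<^sup>+x\<in>snd k ` X. ennreal (R k x) \<partial>lborel)"
      using X k by (intro D borel_chart_subset[OF B]) (auto simp: chart_image_def)
    finally show ?thesis .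
  qed
  then show ?thesis
    using sets_\<mu> unfolding has_chart_densities_def by blast
qed

text \<open>Positive area is what allows the root in the Hawking energy to be differentiated and
  divided by. It holds because a nonempty open chart image is not negligible and the density is
  positive on it.\<close>

lemma emeasure_chart_densities_pos:
  assumes \<mu>: "has_chart_densities B R \<mu>"
  shows "emeasure \<mu> UNIV > 0"
proof -
  obtain k where k: "k \<in> B" "fst k \<noteq> {}"
    using smooth_atlas_cover[OF B] by blast
  have "snd k ` fst k = chart_image k"
    by (simp add: chart_image_def)
  then have eq: "emeasure \<mu> (fst k) = (\<integral>\<^sup>+x\<in>chart_image k. ennreal (R k x) \<partial>lborel)"
    using \<mu> k open_chart_domain[OF B k(1)] by (auto simp: has_chart_densities_def)
  have op: "open (chart_image k)"
    by (rule open_chart_image[OF B k(1)])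
  have m: "(\<lambda>x. ennreal (R k x) * indicator (chart_image k) x) \<in> borel_measurable lborel"
  proof -
    have "(\<lambda>x. ennreal (R k x)) \<in> borel_measurable (restrict_space borel (chart_image k))"
      using density_measurable[OF k(1) order.refl] by measurable
    then show ?thesis
      using op by (subst (asm) borel_measurable_restrict_space_iff_ennreal) auto
  qed
  have "emeasure \<mu> (fst k) \<noteq> 0"
  proof
    assume "emeasure \<mu> (fst k) = 0"
    then have "AE x in lborel. ennreal (R k x) * indicator (chart_image k) x = 0"
      using m unfolding eq by (simp add: nn_integral_0_iff_AE)
    then have "AE x in lborel. x \<notin> chart_image k"
      by (rule eventually_mono)
        (use R k in \<open>auto simp: density_family_def indicator_def ennreal_eq_0_iff not_le[symmetric] split: if_splits\<close>)
    then have "chart_image k \<in> null_sets lborel"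
      using op by (subst (asm) AE_iff_null_sets[symmetric]) auto
    then have "negligible (chart_image k)"
      using negligible_iff_null_sets null_sets_completionI by blast
    then show False
      using op k open_not_negligible by (auto simp: chart_image_def)
  qed
  then show ?thesis
    using emeasure_mono[of "fst k" UNIV \<mu>] \<mu>
    by (auto simp: has_chart_densities_def zero_less_iff_neq_zero)
qed

end

section \<open>The area density of a spacelike surface\<close>

lemma smooth_on_imp_Ck_on: "smooth_on S f \<Longrightarrow> Ck_on k S f"
  by (simp add: smooth_on_def)

lemma smooth_on_imp_differentiable: "smooth_on S f \<Longrightarrow> x \<in> S \<Longrightarrow> f differentiable (at x)"
  using smooth_on_imp_Ck_on[of S f "Suc 0"] by simp

lemma smooth_on_imp_continuous_on: "smooth_on S f \<Longrightarrow> continuous_on S f"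
  using smooth_on_imp_Ck_on[of S f 0] by simp

lemma smooth_on_imp_continuous_on_frechet_derivative:
  "smooth_on S f \<Longrightarrow> continuous_on S (\<lambda>x. frechet_derivative f (at x) v)"
  using smooth_on_imp_Ck_on[of S f "Suc 0"] by simp

section \<open>Gram determinants and their rate of change\<close>

lemma bounded_bilinear_matrix_vector_mult:
  "bounded_bilinear ((*v) :: real^'n^'m \<Rightarrow> real^'n \<Rightarrow> real^'m)"
  unfolding bilinear_conv_bounded_bilinear[symmetric] bilinear_def
  by (auto intro!: linearI simp: matrix_vector_mult_add_rdistrib matrix_vector_right_distrib
      scaleR_matrix_vector_assoc matrix_vector_mult_scaleR)

text \<open>The determinant of the matrix of the form \<open>M\<close> on the frame
  \<open>p\<close>, \<open>q\<close>: the squared area of the parallelogram they span when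
  \<open>M\<close> induces an inner product on their span. Being polynomial in \<open>M\<close>,
  \<open>p\<close> and \<open>q\<close>, it is differentiated by the product rule.\<close>

definition gram :: "real^'n^'n \<Rightarrow> real^'n \<Rightarrow> real^'n \<Rightarrow> real" where
  "gram M p q = (p \<bullet> (M *v p)) * (q \<bullet> (M *v q)) - (p \<bullet> (M *v q)) * (q \<bullet> (M *v p))"

text \<open>A change of frame multiplies the matrix of the form by the coefficient matrix on one
  side and its transpose on the other, hence the determinant by a square.\<close>

lemma gram_linear_combination:
  "gram M (a *\<^sub>R p + b *\<^sub>R q) (c *\<^sub>R p + d *\<^sub>R q) = (a * d - b * c)\<^sup>2 * gram M p q"
  unfolding gram_def
  by (simp add: matrix_vector_right_distrib matrix_vector_mult_scaleR inner_add_left inner_add_right)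
    algebra

lemma continuous_on_gram:
  assumes "continuous_on S M" "continuous_on S p" "continuous_on S q"
  shows "continuous_on S (\<lambda>x. gram (M x) (p x) (q x))"
  unfolding gram_def using assms
  by (intro continuous_intros bounded_bilinear.continuous_on[OF bounded_bilinear_matrix_vector_mult])

text \<open>The product rule for \<open>p \<bullet> (M *v q)\<close>, with primes for velocities.
  \<open>M\<close> has a velocity as well, since it will be the metric at a moving point.\<close>

definition form_rate ::
  "real^'n^'n \<Rightarrow> real^'n \<Rightarrow> real^'n \<Rightarrow> real^'n^'n \<Rightarrow> real^'n \<Rightarrow> real^'n \<Rightarrow> real" where
  "form_rate M p q M' p' q' = p' \<bullet> (M *v q) + p \<bullet> (M' *v q) + p \<bullet> (M *v q')"

definition gram_rate ::
  "real^'n^'n \<Rightarrow> real^'n \<Rightarrow> real^'n \<Rightarrow> real^'n^'n \<Rightarrow> real^'n \<Rightarrow> real^'n \<Rightarrow> real" where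
  "gram_rate M p q M' p' q' =
     form_rate M p p M' p' p' * (q \<bullet> (M *v q)) + (p \<bullet> (M *v p)) * form_rate M q q M' q' q'
     - form_rate M p q M' p' q' * (q \<bullet> (M *v p)) - (p \<bullet> (M *v q)) * form_rate M q p M' q' p'"

lemma form_has_real_derivative:
  assumes "(M has_vector_derivative M') (at t)" "(p has_vector_derivative p') (at t)"
    "(q has_vector_derivative q') (at t)"
  shows "((\<lambda>t. p t \<bullet> (M t *v q t)) has_real_derivative form_rate (M t) (p t) (q t) M' p' q') (at t)"
  unfolding has_real_derivative_iff_has_vector_derivative
  by (rule has_vector_derivative_eq_rhs[OF bounded_bilinear.has_vector_derivative[OF bounded_bilinear_inner assms(2)
        bounded_bilinear.has_vector_derivative[OF bounded_bilinear_matrix_vector_mult assms(1,3)]]])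
    (simp add: form_rate_def inner_add_right)

lemma gram_has_real_derivative:
  assumes "(M has_vector_derivative M') (at t)" "(p has_vector_derivative p') (at t)"
    "(q has_vector_derivative q') (at t)"
  shows "((\<lambda>t. gram (M t) (p t) (q t)) has_real_derivative gram_rate (M t) (p t) (q t) M' p' q') (at t)"
  unfolding gram_def gram_rate_def
  by (rule derivative_eq_intros form_has_real_derivative assms refl)+ simp

lemma continuous_on_gram_rate:
  assumes "continuous_on S M" "continuous_on S p" "continuous_on S q"
    "continuous_on S M'" "continuous_on S p'" "continuous_on S q'"
  shows "continuous_on S (\<lambda>x. gram_rate (M x) (p x) (q x) (M' x) (p' x) (q' x))"
  unfolding gram_rate_def form_rate_def using assms
  by (intro continuous_intros bounded_bilinear.continuous_on[OF bounded_bilinear_matrix_vector_mult])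

section \<open>The density in a fixed ambient chart\<close>

definition area_density ::
  "('m, real^4) chart set \<Rightarrow> 'm metric \<Rightarrow> ('s \<Rightarrow> 'm) \<Rightarrow> ('s, real^2) chart \<Rightarrow> real^2 \<Rightarrow> real" where
  "area_density A G F k x = sqrt (det (induced_metric A G k F (chart_inv k x)))"

lemma surface_atlas: "closed_spacelike_surface A G B F \<Longrightarrow> smooth_atlas B"
  by (simp add: closed_spacelike_surface_def)

lemma compact_surface:
  fixes F :: "'s::{t2_space, second_countable_topology} \<Rightarrow> 'm::topological_space"
  shows "closed_spacelike_surface A G B F \<Longrightarrow> compact (UNIV :: 's set)"
  by (simp add: closed_spacelike_surface_def)

context
  fixes A :: "('m::{t2_space, second_countable_topology}, real^4) chart set"
    and G :: "'m metric"
    and B :: "('s::{t2_space, second_countable_topology}, real^2) chart set"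
    and F :: "'s \<Rightarrow> 'm"
  assumes A: "smooth_atlas A" and G: "lorentzian_metric A G" and F: "closed_spacelike_surface A G B F"
begin

lemma chart_preimage:
  assumes k: "k \<in> B"
  shows "snd k ` (fst k \<inter> F -` fst c) = {x \<in> chart_image k. F (chart_inv k x) \<in> fst c}"
  using chart_image_eq_vimage[OF surface_atlas[OF F] k, of "fst k \<inter> F -` fst c"] chart_inv_mem[OF surface_atlas[OF F] k]
  by auto

lemma open_chart_preimage:
  assumes k: "k \<in> B" and c: "c \<in> A"
  shows "open (snd k ` (fst k \<inter> F -` fst c))"
proof (rule open_chart_subset[OF surface_atlas[OF F] k])
  have "continuous_on UNIV F"
    using F by (simp add: closed_spacelike_surface_def smooth_map_def)
  then show "open (fst k \<inter> F -` fst c)"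
    using open_chart_domain[OF A c] open_chart_domain[OF surface_atlas[OF F] k]
    by (intro open_Int open_vimage)
qed auto

lemma smooth_in_charts:
  assumes "k \<in> B" "c \<in> A"
  shows "smooth_on (snd k ` (fst k \<inter> F -` fst c)) (snd c \<circ> F \<circ> chart_inv k)"
  using F assms by (simp add: closed_spacelike_surface_def smooth_map_def)

lemma differentiable_in_charts:
  assumes "k \<in> B" "c \<in> A" "p \<in> fst k" "F p \<in> fst c"
  shows "(snd c \<circ> F \<circ> chart_inv k) differentiable (at (snd k p))"
  using smooth_on_imp_differentiable[OF smooth_in_charts[OF assms(1,2)], of "snd k p"] assms by auto

text \<open>The chain rule through a transition map of the ambient manifold. Combined with the
  transformation law of \<open>G\<close>, it makes the choice of the target chart
  immaterial.\<close>

lemma differential_change_target_chart: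
  assumes k: "k \<in> B" "p \<in> fst k" and c: "c \<in> A" "F p \<in> fst c" and d: "d \<in> A" "F p \<in> fst d"
  shows "differential A k F p u d
    = frechet_derivative (snd d \<circ> chart_inv c) (at (snd c (F p))) (differential A k F p u c)"
proof -
  define f where "f = snd c \<circ> F \<circ> chart_inv k"
  have p: "chart_inv k (snd k p) = p"
    using chart_inv_chart[OF surface_atlas[OF F]] k by blast
  have df: "f differentiable (at (snd k p))"
    unfolding f_def by (rule differentiable_in_charts) (use assms in auto)
  have dt: "(snd d \<circ> chart_inv c) differentiable (at (snd c (F p)))"
    by (rule transition_differentiable[OF A c(1) d(1) c(2) d(2)])
  have fp: "f (snd k p) = snd c (F p)"
    by (simp add: f_def p)
  have "frechet_derivative (snd d \<circ> F \<circ> chart_inv k) (at (snd k p))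
      = frechet_derivative ((snd d \<circ> chart_inv c) \<circ> f) (at (snd k p))"
  proof (rule frechet_derivative_transform_within_open)
    show "snd d \<circ> F \<circ> chart_inv k differentiable (at (snd k p))"
      by (rule differentiable_in_charts) (use assms in auto)
    show "open (snd k ` (fst k \<inter> F -` fst c))"
      by (rule open_chart_preimage) (use assms in auto)
    show "snd k p \<in> snd k ` (fst k \<inter> F -` fst c)"
      using assms by auto
    show "(snd d \<circ> F \<circ> chart_inv k) x = (snd d \<circ> chart_inv c \<circ> f) x"
      if "x \<in> snd k ` (fst k \<inter> F -` fst c)" for x
      using that chart_inv_chart[OF A c(1)] chart_inv_chart[OF surface_atlas[OF F] k(1)]
      by (auto simp: f_def)
  qed
  also have "\<dots> = frechet_derivative (snd d \<circ> chart_inv c) (at (f (snd k p)))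
      \<circ> frechet_derivative f (at (snd k p))"
    by (rule frechet_derivative_compose) (use df dt fp in auto)
  finally show ?thesis
    using assms fp by (simp add: differential_def f_def)
qed

text \<open>Jacobians of transition maps are isometries between the component matrices, so the chart
  hidden in \<open>metric_inner\<close> may be replaced by any \<open>c\<close> around
  \<open>F p\<close>. With \<open>c\<close> kept fixed, the dependence on the point becomes
  accessible to continuity and differentiation.\<close>

lemma induced_metric_in_charts:
  assumes k: "k \<in> B" "p \<in> fst k" and c: "c \<in> A" "F p \<in> fst c"
  shows "induced_metric A G k F p $ i $ j
    = frechet_derivative (snd c \<circ> F \<circ> chart_inv k) (at (snd k p)) (axis i 1)
      \<bullet> (G c (snd c (F p)) *v frechet_derivative (snd c \<circ> F \<circ> chart_inv k) (at (snd k p)) (axis j 1))"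
proof -
  define d where "d = chart_at A (F p)"
  have d: "d \<in> A" "F p \<in> fst d"
    unfolding d_def using chart_at_mem[OF A] by auto
  define J where "J = frechet_derivative (snd d \<circ> chart_inv c) (at (snd c (F p)))"
  have J: "v \<bullet> (G c (snd c (F p)) *v w) = J v \<bullet> (G d (snd d (F p)) *v J w)" for v w
    using G c d unfolding lorentzian_metric_def J_def Let_def by blast
  have "induced_metric A G k F p $ i $ j
      = differential A k F p (axis i 1) d \<bullet> (G d (snd d (F p)) *v differential A k F p (axis j 1) d)"
    by (simp add: induced_metric_def metric_inner_def Let_def d_def)
  also have "\<dots> = differential A k F p (axis i 1) c \<bullet> (G c (snd c (F p)) *v differential A k F p (axis j 1) c)"
    unfolding J differential_change_target_chart[OF k c d] J_def[symmetric] ..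
  finally show ?thesis
    using c by (simp add: differential_def)
qed

lemma det_induced_metric_in_charts:
  assumes k: "k \<in> B" "p \<in> fst k" and c: "c \<in> A" "F p \<in> fst c"
  shows "det (induced_metric A G k F p) = gram (G c (snd c (F p)))
     (frechet_derivative (snd c \<circ> F \<circ> chart_inv k) (at (snd k p)) (axis 1 1))
     (frechet_derivative (snd c \<circ> F \<circ> chart_inv k) (at (snd k p)) (axis 2 1))"
  unfolding det_2 gram_def induced_metric_in_charts[OF assms] ..

lemma det_induced_metric_pos:
  assumes k: "k \<in> B" "p \<in> fst k"
  shows "det (induced_metric A G k F p) > 0"
proof -
  define h where "h = induced_metric A G k F p"
  have pos: "0 < u \<bullet> (h *v u)" if "u \<noteq> 0" for u
    using F k that unfolding closed_spacelike_surface_def h_def by blast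
  have quad: "u \<bullet> (h *v u) = h $ 1 $ 1 * (u $ 1)\<^sup>2 + (h $ 1 $ 2 + h $ 2 $ 1) * u $ 1 * u $ 2 + h $ 2 $ 2 * (u $ 2)\<^sup>2" for u
    by (simp add: inner_vec_def matrix_vector_mult_def sum_2 algebra_simps power2_eq_square)
  have sym: "h $ 1 $ 2 = h $ 2 $ 1"
  proof -
    define c where "c = chart_at A (F p)"
    have c: "c \<in> A" "F p \<in> fst c"
      unfolding c_def using chart_at_mem[OF A] by auto
    have "transpose (G c (snd c (F p))) = G c (snd c (F p))"
      using G c chart_mem[OF A c] unfolding lorentzian_metric_def by blast
    then have "u \<bullet> (G c (snd c (F p)) *v w) = w \<bullet> (G c (snd c (F p)) *v u)" for u w
      using dot_lmul_matrix[of u "G c (snd c (F p))" w]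
      by (simp add: transpose_matrix_vector[symmetric] inner_commute)
    then show ?thesis
      unfolding h_def induced_metric_in_charts[OF k c] by this
  qed
  have a: "h $ 1 $ 1 > 0"
    using pos[of "axis 1 1"] by (simp add: quad) (simp add: axis_def)
  \<comment> \<open>This vector is orthogonal to the first row of \<open>h\<close>, so
    \<open>h\<close> maps it to \<open>(0, det h)\<close>, and the form takes the value
    \<open>h $ 1 $ 1 * det h\<close> on it.\<close>
  have "(vector [- h $ 1 $ 2, h $ 1 $ 1] :: real^2) \<noteq> 0"
    using a by (metis less_irrefl vector_2(2) zero_index)
  from pos[OF this] have "h $ 1 $ 1 * (h $ 1 $ 1 * h $ 2 $ 2 - h $ 1 $ 2 * h $ 2 $ 1) > 0"
    by (simp add: quad sym power2_eq_square algebra_simps)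
  then show ?thesis
    using a by (simp add: det_2 h_def zero_less_mult_iff)
qed

lemma area_density_in_charts:
  assumes k: "k \<in> B" and c: "c \<in> A" and x: "x \<in> snd k ` (fst k \<inter> F -` fst c)"
  shows "area_density A G F k x = sqrt (gram (G c ((snd c \<circ> F \<circ> chart_inv k) x))
     (frechet_derivative (snd c \<circ> F \<circ> chart_inv k) (at x) (axis 1 1))
     (frechet_derivative (snd c \<circ> F \<circ> chart_inv k) (at x) (axis 2 1)))"
proof -
  obtain p where p: "p \<in> fst k" "F p \<in> fst c" "x = snd k p"
    using x by blast
  then show ?thesis
    using det_induced_metric_in_charts[OF k p(1) c p(2)] chart_inv_chart[OF surface_atlas[OF F] k p(1)]
    by (simp add: area_density_def)
qed

lemma area_density_pos:
  assumes "k \<in> B" "x \<in> chart_image k"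
  shows "area_density A G F k x > 0"
  using det_induced_metric_pos[OF assms(1) chart_inv_mem[OF surface_atlas[OF F] assms]]
  by (simp add: area_density_def)

lemma smooth_metric: "c \<in> A \<Longrightarrow> smooth_on (chart_image c) (G c)"
  using G by (simp add: lorentzian_metric_def)

lemma continuous_on_area_density:
  assumes k: "k \<in> B"
  shows "continuous_on (chart_image k) (area_density A G F k)"
  unfolding continuous_on_eq_continuous_at[OF open_chart_image[OF surface_atlas[OF F] k]]
proof
  fix x assume x: "x \<in> chart_image k"
  define c where "c = chart_at A (F (chart_inv k x))"
  have c: "c \<in> A" "F (chart_inv k x) \<in> fst c"
    unfolding c_def using chart_at_mem[OF A] by auto
  define N where "N = snd k ` (fst k \<inter> F -` fst c)"
  have N: "open N" "x \<in> N"
    using open_chart_preimage[OF k c(1)] x c unfolding N_def chart_preimage[OF k] by auto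
  have sm: "smooth_on N (snd c \<circ> F \<circ> chart_inv k)"
    using smooth_in_charts[OF k c(1)] unfolding N_def .
  have im: "(snd c \<circ> F \<circ> chart_inv k) ` N \<subseteq> chart_image c"
    unfolding N_def chart_preimage[OF k] using chart_mem[OF A c(1)] by auto
  have "continuous_on N (\<lambda>x. G c ((snd c \<circ> F \<circ> chart_inv k) x))"
    by (rule continuous_on_compose2[OF smooth_on_imp_continuous_on[OF smooth_metric[OF c(1)]]
          smooth_on_imp_continuous_on[OF sm] im])
  then have "continuous_on N (\<lambda>x. sqrt (gram (G c ((snd c \<circ> F \<circ> chart_inv k) x))
     (frechet_derivative (snd c \<circ> F \<circ> chart_inv k) (at x) (axis 1 1))
     (frechet_derivative (snd c \<circ> F \<circ> chart_inv k) (at x) (axis 2 1))))"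
    by (intro continuous_on_real_sqrt continuous_on_gram
        smooth_on_imp_continuous_on_frechet_derivative[OF sm])
  then have "continuous_on N (area_density A G F k)"
    by (rule continuous_on_eq) (simp add: area_density_in_charts[OF k c(1)] N_def)
  then show "isCont (area_density A G F k) x"
    using N by (simp add: continuous_on_eq_continuous_at)
qed

text \<open>By the chain rule the frame of \<open>k\<close> is the frame of \<open>l\<close>
  combined by the Jacobian. The Gram determinant acquires the squared determinant, and the root
  leaves its absolute value.\<close>

lemma area_density_change_of_chart:
  assumes k: "k \<in> B" "p \<in> fst k" and l: "l \<in> B" "p \<in> fst l"
  shows "area_density A G F k (snd k p)
    = \<bar>det (matrix (frechet_derivative (snd l \<circ> chart_inv k) (at (snd k p))))\<bar> * area_density A G F l (snd l p)"
proof -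
  define c where "c = chart_at A (F p)"
  have c: "c \<in> A" "F p \<in> fst c"
    unfolding c_def using chart_at_mem[OF A] by auto
  define J where "J = frechet_derivative (snd l \<circ> chart_inv k) (at (snd k p))"
  define D where "D = frechet_derivative (snd c \<circ> F \<circ> chart_inv l) (at (snd l p))"
  have dt: "(snd l \<circ> chart_inv k) differentiable (at (snd k p))"
    by (rule transition_differentiable[OF surface_atlas[OF F] k(1) l(1) k(2) l(2)])
  have p: "(snd l \<circ> chart_inv k) (snd k p) = snd l p"
    using chart_inv_chart[OF surface_atlas[OF F] k] by simp
  have df: "(snd c \<circ> F \<circ> chart_inv l) differentiable (at (snd l p))"
    by (rule differentiable_in_charts) (use assms c in auto)
  have "frechet_derivative (snd c \<circ> F \<circ> chart_inv k) (at (snd k p))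
      = frechet_derivative ((snd c \<circ> F \<circ> chart_inv l) \<circ> (snd l \<circ> chart_inv k)) (at (snd k p))"
  proof (rule frechet_derivative_transform_within_open)
    show "snd c \<circ> F \<circ> chart_inv k differentiable (at (snd k p))"
      by (rule differentiable_in_charts) (use assms c in auto)
    show "open (snd k ` (fst k \<inter> fst l))"
      using open_chart_domain[OF surface_atlas[OF F] k(1)] open_chart_domain[OF surface_atlas[OF F] l(1)]
      by (intro open_chart_subset[OF surface_atlas[OF F] k(1)] open_Int) auto
    show "snd k p \<in> snd k ` (fst k \<inter> fst l)"
      using assms by auto
    show "(snd c \<circ> F \<circ> chart_inv k) x = (snd c \<circ> F \<circ> chart_inv l \<circ> (snd l \<circ> chart_inv k)) x"
      if "x \<in> snd k ` (fst k \<inter> fst l)" for x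
      using that chart_inv_chart[OF surface_atlas[OF F] l(1)] chart_inv_chart[OF surface_atlas[OF F] k(1)] by auto
  qed
  also have "\<dots> = D \<circ> J"
    unfolding D_def J_def p[symmetric] by (rule frechet_derivative_compose) (use dt df p in auto)
  finally have Dk: "frechet_derivative (snd c \<circ> F \<circ> chart_inv k) (at (snd k p)) = D \<circ> J" .
  have lin: "linear D" "linear J"
    using linear_frechet_derivative df dt unfolding D_def J_def by blast+
  define a where "a i j = J (axis j 1) $ i" for i j
  have J: "J (axis j 1) = a 1 j *\<^sub>R axis 1 1 + a 2 j *\<^sub>R axis 2 1" for j
    by (simp add: vec_eq_iff forall_2 a_def axis_def)
  have DJ: "D (J (axis j 1)) = a 1 j *\<^sub>R D (axis 1 1) + a 2 j *\<^sub>R D (axis 2 1)" for j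
    by (subst J) (simp add: linear_add[OF lin(1)] linear_cmul[OF lin(1)])
  have detJ: "det (matrix J) = a 1 1 * a 2 2 - a 2 1 * a 1 2"
    by (simp add: det_2 matrix_def a_def)
  have "det (induced_metric A G k F p) = (det (matrix J))\<^sup>2 * det (induced_metric A G l F p)"
    unfolding det_induced_metric_in_charts[OF k c] det_induced_metric_in_charts[OF l c] Dk
      D_def[symmetric] detJ
    by (simp add: DJ gram_linear_combination)
  then show ?thesis
    unfolding area_density_def chart_inv_chart[OF surface_atlas[OF F] k] chart_inv_chart[OF surface_atlas[OF F] l]
      J_def[symmetric] by (simp add: real_sqrt_mult)
qed

lemma density_family_area_density: "density_family B (area_density A G F)"
  unfolding density_family_def
  using continuous_on_area_density area_density_pos area_density_change_of_chart by blast

text \<open>Existence and uniqueness together make the definite description in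
  \<open>area_measure\<close> denote.\<close>

lemma has_chart_densities_area_measure:
  "has_chart_densities B (area_density A G F) (area_measure A G B F)"
proof -
  have "area_measure A G B F = (THE \<mu>. has_chart_densities B (area_density A G F) \<mu>)"
    by (simp add: area_measure_def has_chart_densities_def area_density_def)
  moreover have "\<exists>!\<mu>. has_chart_densities B (area_density A G F) \<mu>"
    using has_chart_densities_exists[OF surface_atlas[OF F] density_family_area_density compact_surface[OF F]]
      has_chart_densities_unique[OF surface_atlas[OF F] density_family_area_density compact_surface[OF F]] by blast
  ultimately show ?thesis
    by (metis theI')
qed

end

section \<open>The first variation of area\<close>

text \<open>Dominated convergence for the difference quotients. The bound comes from compactness:
  \<open>r'\<close> is bounded on \<open>{-d..d} \<times> K\<close>, and by the mean value
  inequality so are the quotients.\<close>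

lemma has_real_derivative_set_integral:
  fixes r r' :: "real \<Rightarrow> 'a::euclidean_space \<Rightarrow> real"
  assumes d: "0 < d" and K: "compact K" and Y: "Y \<in> sets borel" "Y \<subseteq> K"
    and r: "\<And>t x. \<bar>t\<bar> \<le> d \<Longrightarrow> x \<in> K \<Longrightarrow> ((\<lambda>s. r s x) has_real_derivative r' t x) (at t)"
    and cont: "\<And>t. \<bar>t\<bar> \<le> d \<Longrightarrow> continuous_on K (r t)"
    and cont': "continuous_on ({-d..d} \<times> K) (\<lambda>(t, x). r' t x)"
  shows "\<And>t. \<bar>t\<bar> \<le> d \<Longrightarrow> set_integrable lborel Y (r t)"
    and "((\<lambda>t. LINT x:Y|lborel. r t x) has_real_derivative (LINT x:Y|lborel. r' 0 x)) (at 0)"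
proof -
  show int: "set_integrable lborel Y (r t)" if "\<bar>t\<bar> \<le> d" for t
    by (rule set_integrable_subset[OF borel_integrable_compact[OF K cont[OF that], folded set_integrable_def]])
      (use Y in auto)
  have cont0: "continuous_on K (r' 0)"
    by (rule continuous_on_compose2[OF cont', of K "\<lambda>x. (0, x)", simplified])
      (use d in \<open>auto intro!: continuous_intros\<close>)
  then have int0: "set_integrable lborel Y (r' 0)"
    by (intro set_integrable_subset[OF borel_integrable_compact[OF K, folded set_integrable_def]]) (use Y in auto)
  have "compact ((\<lambda>(t, x). r' t x) ` ({-d..d} \<times> K))"
    using K by (intro compact_continuous_image[OF cont'] compact_Times) auto
  then have "bounded ((\<lambda>(t, x). r' t x) ` ({-d..d} \<times> K))"
    by (rule compact_imp_bounded)
  then obtain C where "\<forall>y\<in>(\<lambda>(t, x). r' t x) ` ({-d..d} \<times> K). norm y \<le> C"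
    unfolding bounded_iff by blast
  then have C: "\<bar>r' t x\<bar> \<le> C" if "\<bar>t\<bar> \<le> d" "x \<in> K" for t x
    using that by (force simp: abs_le_iff)
  have quot: "\<bar>(r h x - r 0 x) / h\<bar> \<le> C" if "\<bar>h\<bar> \<le> d" "h \<noteq> 0" "x \<in> K" for h x
  proof -
    have "\<bar>r h x - r 0 x\<bar> \<le> C * \<bar>h - 0\<bar>"
      unfolding real_norm_def[symmetric]
    proof (rule field_differentiable_bound)
      show "convex {-d..d}"
        by simp
      show "((\<lambda>s. r s x) has_field_derivative r' z x) (at z within {-d..d})"
        "norm (r' z x) \<le> C" if "z \<in> {-d..d}" for z
        using r[of z x] C[of z x] that \<open>x \<in> K\<close>
        by (auto simp: abs_le_iff intro: has_field_derivative_at_within)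
      show "h \<in> {-d..d}" "0 \<in> {-d..d}"
        using that d by (auto simp: abs_le_iff)
    qed
    then show ?thesis
      using that by (simp add: divide_le_eq)
  qed
  have "((\<lambda>h. ((LINT x:Y|lborel. r h x) - (LINT x:Y|lborel. r 0 x)) / h) \<longlongrightarrow> (LINT x:Y|lborel. r' 0 x)) (at 0)"
    \<comment> \<open>Dominated convergence is about sequences, so the limit is tested along
      arbitrary null sequences.\<close>
    unfolding tendsto_at_iff_sequentially comp_def
  proof (intro allI impI)
    fix X :: "nat \<Rightarrow> real"
    assume X: "\<forall>i. X i \<in> UNIV - {0}" "X \<longlonglongrightarrow> 0"
    \<comment> \<open>Finitely many terms of the sequence may exceed \<open>d\<close>, where the
      quotients are not controlled; there the integrand is set to 0.\<close>
    define s where "s i x = indicator Y x *\<^sub>R (if \<bar>X i\<bar> \<le> d then (r (X i) x - r 0 x) / X i else 0)" for i x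
    have ev: "\<forall>\<^sub>F i in sequentially. \<bar>X i\<bar> \<le> d"
      using tendstoD[OF X(2) d] by (auto elim!: eventually_mono)
    have "set_integrable lborel K (\<lambda>_. C)"
      unfolding set_integrable_def by (rule borel_integrable_compact[OF K]) simp
    then have intC: "integrable lborel (\<lambda>x. indicator Y x *\<^sub>R C)"
      using set_integrable_subset[of lborel K "\<lambda>_. C" Y] Y by (simp add: set_integrable_def)
    have ints: "integrable lborel (\<lambda>x. indicator Y x *\<^sub>R ((r (X i) x - r 0 x) / X i))" if "\<bar>X i\<bar> \<le> d" for i
      using set_integral_diff(1)[OF int[OF that] int[of 0]] d
      by (intro set_integrable_divide[unfolded set_integrable_def]) (auto simp: set_integrable_def)
    have meas: "s i \<in> borel_measurable lborel" for i
      using borel_measurable_integrable[OF ints[of i]] by (cases "\<bar>X i\<bar> \<le> d") (auto simp: s_def[abs_def])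
    have "(\<lambda>i. integral\<^sup>L lborel (s i)) \<longlonglongrightarrow> integral\<^sup>L lborel (\<lambda>x. indicator Y x *\<^sub>R r' 0 x)"
    proof (rule integral_dominated_convergence[where w = "\<lambda>x. indicator Y x *\<^sub>R C"])
      show "(\<lambda>x. indicator Y x *\<^sub>R r' 0 x) \<in> borel_measurable lborel"
        using int0 by (simp add: set_integrable_def borel_measurable_integrable)
      show "AE x in lborel. norm (s i x) \<le> indicator Y x *\<^sub>R C" for i
      proof (rule AE_I2)
        fix x
        have "0 \<le> C" if "x \<in> Y"
          using C[of 0 x] that Y d by auto
        then show "norm (s i x) \<le> indicator Y x *\<^sub>R C"
          using quot[of "X i" x] X(1) Y by (auto simp: s_def indicator_def)
      qed
      show "AE x in lborel. (\<lambda>i. s i x) \<longlonglongrightarrow> indicator Y x *\<^sub>R r' 0 x"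
      proof (rule AE_I2)
        fix x
        show "(\<lambda>i. s i x) \<longlonglongrightarrow> indicator Y x *\<^sub>R r' 0 x"
        proof (cases "x \<in> Y")
          case True
          then have "((\<lambda>h. (r h x - r 0 x) / h) \<longlongrightarrow> r' 0 x) (at 0)"
            using r[of 0 x] Y d by (auto simp: DERIV_def)
          then have "(\<lambda>i. (r (X i) x - r 0 x) / X i) \<longlonglongrightarrow> r' 0 x"
            using X unfolding tendsto_at_iff_sequentially comp_def by blast
          then have "(\<lambda>i. s i x) \<longlonglongrightarrow> r' 0 x"
            by (rule Lim_transform_eventually) (use ev True in \<open>auto simp: s_def elim!: eventually_mono\<close>)
          then show ?thesis
            using True by simp
        qed (simp add: s_def)
      qed
    qed (use intC meas in auto)
    then have "(\<lambda>i. integral\<^sup>L lborel (s i)) \<longlonglongrightarrow> (LINT x:Y|lborel. r' 0 x)"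
      by (simp add: set_lebesgue_integral_def)
    moreover have "\<forall>\<^sub>F i in sequentially. integral\<^sup>L lborel (s i)
        = ((LINT x:Y|lborel. r (X i) x) - (LINT x:Y|lborel. r 0 x)) / X i"
      using ev
    proof eventually_elim
      case (elim i)
      then have "integral\<^sup>L lborel (s i) = (LINT x:Y|lborel. (r (X i) x - r 0 x) / X i)"
        by (simp add: s_def[abs_def] set_lebesgue_integral_def)
      also have "\<dots> = (LINT x:Y|lborel. r (X i) x - r 0 x) / X i"
        by (rule set_integral_divide_zero)
      also have "\<dots> = ((LINT x:Y|lborel. r (X i) x) - (LINT x:Y|lborel. r 0 x)) / X i"
        using set_integral_diff(2)[OF int[OF elim] int[of 0]] d by simp
      finally show ?case .
    qed
    ultimately show "(\<lambda>i. ((LINT x:Y|lborel. r (X i) x) - (LINT x:Y|lborel. r 0 x)) / X i)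
        \<longlonglongrightarrow> (LINT x:Y|lborel. r' 0 x)"
      by (rule Lim_transform_eventually)
  qed
  then show "((\<lambda>t. LINT x:Y|lborel. r t x) has_real_derivative (LINT x:Y|lborel. r' 0 x)) (at 0)"
    by (simp add: DERIV_def)
qed

text \<open>
  Here \<open>w\<close> is the coordinate expression of the initial velocity of a variation of \<open>f\<close>: by the symmetry
  of second derivatives the frame \<open>\<partial>\<^sub>1 f, \<partial>\<^sub>2 f\<close> moves with velocity \<open>\<partial>\<^sub>1 w, \<partial>\<^sub>2 w\<close>.
\<close>

definition area_density_rate ::
  "'m metric \<Rightarrow> ('m, real^4) chart \<Rightarrow> (real^2 \<Rightarrow> real^4) \<Rightarrow> (real^2 \<Rightarrow> real^4) \<Rightarrow> real^2 \<Rightarrow> real" where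
  "area_density_rate G c f w x =
     (let p = frechet_derivative f (at x) (axis 1 1); q = frechet_derivative f (at x) (axis 2 1) in
      gram_rate (G c (f x)) p q (frechet_derivative (G c) (at (f x)) (w x))
        (frechet_derivative w (at x) (axis 1 1)) (frechet_derivative w (at x) (axis 2 1))
      / (2 * sqrt (gram (G c (f x)) p q)))"

section \<open>The density along a variation\<close>

context
  fixes A :: "('m::{t2_space, second_countable_topology}, real^4) chart set"
    and G :: "'m metric"
    and B :: "('s::{t2_space, second_countable_topology}, real^2) chart set"
    and F :: "'s \<Rightarrow> 'm" and W :: "'s \<Rightarrow> ('m, real^4) tvec" and \<Phi> :: "real \<Rightarrow> 's \<Rightarrow> 'm"
    and k c K
  assumes A: "smooth_atlas A" and G: "lorentzian_metric A G" and F: "closed_spacelike_surface A G B F"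
    and \<Phi>: "variation A G B F W \<Phi>"
    and k: "k \<in> B" and c: "c \<in> A" and K: "compact K" "K \<subseteq> snd k ` (fst k \<inter> F -` fst c)"
begin

text \<open>Over the compact \<open>K\<close> one ambient chart serves for a whole interval of
  times, and there the density is the root of a positive Gram determinant. In the last clause
  nothing of \<open>\<Phi>\<close> is left except \<open>F\<close> and \<open>W\<close>.\<close>

lemma area_density_variation:
  obtains d r' where "0 < d"
    "\<And>t. \<bar>t\<bar> \<le> d \<Longrightarrow> closed_spacelike_surface A G B (\<Phi> t)"
    "\<And>t x. \<bar>t\<bar> \<le> d \<Longrightarrow> x \<in> K \<Longrightarrow>
      ((\<lambda>s. area_density A G (\<Phi> s) k x) has_real_derivative r' t x) (at t)"
    "continuous_on ({-d..d} \<times> K) (\<lambda>(t, x). r' t x)"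
    "\<And>x. x \<in> K \<Longrightarrow> r' 0 x = area_density_rate G c (snd c \<circ> F \<circ> chart_inv k) (\<lambda>x. W (chart_inv k x) c) x"
proof -
  obtain e where e: "0 < e"
    and contP: "continuous_on ({-e<..<e} \<times> UNIV) (\<lambda>(t, p). \<Phi> t p)"
    and smP: "smooth_on {(t, x). t \<in> {-e<..<e} \<and> x \<in> chart_image k \<and> \<Phi> t (chart_inv k x) \<in> fst c}
      (\<lambda>(t, x). snd c (\<Phi> t (chart_inv k x)))"
    and surf: "\<And>t. t \<in> {-e<..<e} \<Longrightarrow> closed_spacelike_surface A G B (\<Phi> t)"
    using \<Phi> k c unfolding variation_def by blast
  have \<Phi>0: "\<Phi> 0 = F"
    and vel: "\<And>p. F p \<in> fst c \<Longrightarrow> ((\<lambda>t. snd c (\<Phi> t p)) has_vector_derivative W p c) (at 0)"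
    using \<Phi> c unfolding variation_def by blast+
  note atlas = surface_atlas[OF F]
  define U where "U = {(t, x). t \<in> {-e<..<e} \<and> x \<in> chart_image k \<and> \<Phi> t (chart_inv k x) \<in> fst c}"
  define \<phi> where "\<phi> = (\<lambda>(t, x). snd c (\<Phi> t (chart_inv k x)))"
  have sm: "smooth_on U \<phi>"
    using smP unfolding U_def \<phi>_def .
  have opU: "open U"
  proof -
    have "continuous_on ({-e<..<e} \<times> chart_image k) ((\<lambda>(t, p). \<Phi> t p) \<circ> (\<lambda>(t, x). (t, chart_inv k x)))"
    proof (rule continuous_on_compose)
      show "continuous_on ({-e<..<e} \<times> chart_image k) (\<lambda>(t, x). (t, chart_inv k x))"
        using continuous_on_chart_inv[OF atlas k] unfolding split_beta
        by (intro continuous_intros continuous_on_compose2[of "chart_image k" "chart_inv k" _ snd]) auto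
      show "continuous_on ((\<lambda>(t, x). (t, chart_inv k x)) ` ({-e<..<e} \<times> chart_image k)) (\<lambda>(t, p). \<Phi> t p)"
        by (rule continuous_on_subset[OF contP]) auto
    qed
    then have "open (((\<lambda>(t, p). \<Phi> t p) \<circ> (\<lambda>(t, x). (t, chart_inv k x))) -` fst c \<inter> ({-e<..<e} \<times> chart_image k))"
      using open_chart_domain[OF A c] open_chart_image[OF atlas k]
      by (subst (asm) continuous_on_open_vimage) (auto intro!: open_Times)
    also have "((\<lambda>(t, p). \<Phi> t p) \<circ> (\<lambda>(t, x). (t, chart_inv k x))) -` fst c \<inter> ({-e<..<e} \<times> chart_image k) = U"
      unfolding U_def by auto
    finally show ?thesis .
  qed
  have 0: "(0, x) \<in> U" if "x \<in> K" for x
    using that K(2) e unfolding U_def chart_preimage[OF A G F k] by (auto simp: \<Phi>0)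
  then have "{0} \<times> K \<subseteq> U"
    by auto
  \<comment> \<open>Compactness of \<open>K\<close> gives one time interval that is valid for all
    its points.\<close>
  from Elementary_Topology.tube_lemma[OF K(1) opU this] obtain X0 where X0: "0 \<in> X0" "open X0" "X0 \<times> K \<subseteq> U"
    by blast
  then obtain d0 where d0: "0 < d0" "cball 0 d0 \<subseteq> X0"
    using open_contains_cball by blast
  define d where "d = d0"
  have d: "0 < d" "\<And>t x. \<bar>t\<bar> \<le> d \<Longrightarrow> x \<in> K \<Longrightarrow> (t, x) \<in> U"
    using d0 X0(3) by (auto simp: d_def subset_iff)
  \<comment> \<open>\<open>P i\<close> is the coordinate frame, \<open>Q\<close> the velocity and
    \<open>M\<close> the metric at the moving point; primes are time derivatives.\<close>
  define P where "P i z = frechet_derivative \<phi> (at z) (0, axis i 1)" for i :: 2 and z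
  define Q where "Q z = frechet_derivative \<phi> (at z) (1, 0)" for z
  define P' where "P' i z = frechet_derivative (P i) (at z) (1, 0)" for i z
  define M where "M z = G c (\<phi> z)" for z
  define M' where "M' z = frechet_derivative (G c) (at (\<phi> z)) (Q z)" for z
  define r' where "r' t x = gram_rate (M (t, x)) (P 1 (t, x)) (P 2 (t, x)) (M' (t, x)) (P' 1 (t, x)) (P' 2 (t, x))
      / (2 * sqrt (gram (M (t, x)) (P 1 (t, x)) (P 2 (t, x))))" for t x
  have Ck: "Ck_on (Suc (Suc 0)) U \<phi>"
    using sm unfolding smooth_on_def by blast
  have \<phi>diff: "\<phi> differentiable (at z)" if "z \<in> U" for z
    using Ck that by simp
  have Pdiff: "P i differentiable (at z)" if "z \<in> U" for i z
    using Ck that unfolding P_def[abs_def] by simp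
  have im: "\<phi> z \<in> chart_image c" if "z \<in> U" for z
    using that chart_mem[OF A c] by (auto simp: U_def \<phi>_def)
  have Gdiff: "G c differentiable (at y)" if "y \<in> chart_image c" for y
    using smooth_on_imp_differentiable[OF smooth_metric[OF A G F c]] that .
  have cont_\<phi>: "continuous_on U \<phi>"
    by (rule smooth_on_imp_continuous_on[OF sm])
  have cont_P: "continuous_on U (P i)" for i
    unfolding P_def[abs_def] by (rule smooth_on_imp_continuous_on_frechet_derivative[OF sm])
  have cont_Q: "continuous_on U Q"
    unfolding Q_def[abs_def] by (rule smooth_on_imp_continuous_on_frechet_derivative[OF sm])
  have cont_P': "continuous_on U (P' i)" for i
    using Ck unfolding P_def[abs_def] P'_def[abs_def] by simp
  have cont_M: "continuous_on U M"
    unfolding M_def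
    by (rule continuous_on_compose2[OF smooth_on_imp_continuous_on[OF smooth_metric[OF A G F c]] cont_\<phi>])
      (use im in auto)
  \<comment> \<open>Smoothness of \<open>G c\<close> gives continuity of its derivative in a fixed
    direction only. The direction \<open>Q z\<close> varies, so it is expanded in the standard
    basis.\<close>
  have "continuous_on U (\<lambda>z. \<Sum>i\<in>UNIV. Q z $ i *\<^sub>R frechet_derivative (G c) (at (\<phi> z)) (axis i 1))"
    by (intro continuous_intros cont_Q continuous_on_compose2[OF
          smooth_on_imp_continuous_on_frechet_derivative[OF smooth_metric[OF A G F c]] cont_\<phi>])
      (use im in auto)
  moreover have "(\<Sum>i\<in>UNIV. Q z $ i *\<^sub>R frechet_derivative (G c) (at (\<phi> z)) (axis i 1)) = M' z"
    if "z \<in> U" for z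
  proof -
    have lin: "linear (frechet_derivative (G c) (at (\<phi> z)))"
      by (rule linear_frechet_derivative[OF Gdiff[OF im[OF that]]])
    have "M' z = frechet_derivative (G c) (at (\<phi> z)) (\<Sum>i\<in>UNIV. Q z $ i *\<^sub>R axis i 1)"
      unfolding M'_def using basis_expansion[of "Q z"] by (simp add: scalar_mult_eq_scaleR)
    then show ?thesis
      by (simp add: linear_sum[OF lin] linear_cmul[OF lin])
  qed
  ultimately have cont_M': "continuous_on U M'"
    by (rule continuous_on_eq)
  have slice: "(snd c \<circ> \<Phi> t \<circ> chart_inv k has_derivative (\<lambda>v. frechet_derivative \<phi> (at (t, x)) (0, v))) (at x)"
    if "(t, x) \<in> U" for t x
  proof -
    have "(\<phi> has_derivative frechet_derivative \<phi> (at (t, x))) (at (t, x))"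
      using \<phi>diff[OF that] by (simp only: frechet_derivative_works)
    from has_derivative_compose[where f = "\<lambda>x. (t, x)" and g = \<phi>,
        OF has_derivative_Pair[OF has_derivative_const has_derivative_ident] this]
    have "((\<lambda>x. \<phi> (t, x)) has_derivative (\<lambda>v. frechet_derivative \<phi> (at (t, x)) (0, v))) (at x)" .
    then show ?thesis
      by (simp add: \<phi>_def o_def)
  qed
  have P_eq: "frechet_derivative (snd c \<circ> \<Phi> t \<circ> chart_inv k) (at x) (axis i 1) = P i (t, x)"
    if "(t, x) \<in> U" for t x i
    using frechet_derivative_at[OF slice[OF that]] by (metis P_def)
  have density: "area_density A G (\<Phi> t) k x = sqrt (gram (M (t, x)) (P 1 (t, x)) (P 2 (t, x)))"
    and gram_pos: "gram (M (t, x)) (P 1 (t, x)) (P 2 (t, x)) > 0"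
    if "(t, x) \<in> U" for t x
  proof -
    have t: "closed_spacelike_surface A G B (\<Phi> t)"
      using that surf by (simp add: U_def)
    have x: "x \<in> snd k ` (fst k \<inter> \<Phi> t -` fst c)"
      using that unfolding chart_preimage[OF A G t k] by (simp add: U_def)
    show eq: "area_density A G (\<Phi> t) k x = sqrt (gram (M (t, x)) (P 1 (t, x)) (P 2 (t, x)))"
      unfolding area_density_in_charts[OF A G t k c x] P_eq[OF that] by (simp add: M_def \<phi>_def)
    have "x \<in> chart_image k"
      using that by (simp add: U_def)
    from area_density_pos[OF A G t k this] show "gram (M (t, x)) (P 1 (t, x)) (P 2 (t, x)) > 0"
      unfolding eq by simp
  qed
  have time: "((\<lambda>s. g (s, x)) has_vector_derivative frechet_derivative g (at (t, x)) (1, 0)) (at t)"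
    if "g differentiable (at (t, x))" for g :: "real \<times> (real^2) \<Rightarrow> real^4" and t x
  proof -
    have g: "(g has_derivative frechet_derivative g (at (t, x))) (at (t, x))"
      using that by (simp only: frechet_derivative_works)
    from has_derivative_compose[where f = "\<lambda>s. (s, x)" and g = g,
        OF has_derivative_Pair[OF has_derivative_ident has_derivative_const] g]
    have "((\<lambda>s. g (s, x)) has_derivative (\<lambda>h. frechet_derivative g (at (t, x)) (h, 0))) (at t)" .
    moreover have "(\<lambda>h. frechet_derivative g (at (t, x)) (h, 0))
        = (\<lambda>h. h *\<^sub>R frechet_derivative g (at (t, x)) (1, 0))"
    proof
      fix h :: real
      have "(h, 0 :: real^2) = h *\<^sub>R (1, 0)"
        by simp
      then show "frechet_derivative g (at (t, x)) (h, 0) = h *\<^sub>R frechet_derivative g (at (t, x)) (1, 0)"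
        by (simp only: linear_cmul[OF linear_frechet_derivative[OF that]])
    qed
    ultimately show ?thesis
      by (simp only: has_vector_derivative_def)
  qed
  have timeM: "((\<lambda>s. M (s, x)) has_vector_derivative M' (t, x)) (at t)" if "(t, x) \<in> U" for t x
  proof -
    have g: "(G c has_derivative frechet_derivative (G c) (at (\<phi> (t, x)))) (at (\<phi> (t, x)))"
      using Gdiff[OF im[OF that]] by (simp only: frechet_derivative_works)
    have "((\<lambda>s. \<phi> (s, x)) has_derivative (\<lambda>h. h *\<^sub>R Q (t, x))) (at t)"
      using time[OF \<phi>diff[OF that]] by (simp add: has_vector_derivative_def Q_def)
    from has_derivative_compose[where f = "\<lambda>s. \<phi> (s, x)" and g = "G c", OF this g]
    show ?thesis
      unfolding M_def M'_def has_vector_derivative_def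
      using linear_cmul[OF linear_frechet_derivative[OF Gdiff[OF im[OF that]]]] by simp
  qed
  have deriv: "((\<lambda>s. area_density A G (\<Phi> s) k x) has_real_derivative r' t x) (at t)" if "(t, x) \<in> U" for t x
  proof -
    have "((\<lambda>s. gram (M (s, x)) (P 1 (s, x)) (P 2 (s, x))) has_real_derivative
        gram_rate (M (t, x)) (P 1 (t, x)) (P 2 (t, x)) (M' (t, x)) (P' 1 (t, x)) (P' 2 (t, x))) (at t)"
      unfolding P'_def by (intro gram_has_real_derivative timeM time Pdiff that)
    from DERIV_chain2[OF DERIV_real_sqrt[OF gram_pos[OF that]] this]
    have D: "((\<lambda>s. sqrt (gram (M (s, x)) (P 1 (s, x)) (P 2 (s, x)))) has_real_derivative r' t x) (at t)"
      by (simp add: r'_def field_simps)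
    \<comment> \<open>The formula for the density holds only while \<open>(s, x)\<close> stays in
      \<open>U\<close>; openness makes these times a neighbourhood of \<open>t\<close>.\<close>
    have "open ((\<lambda>s. (s, x)) -` U)"
      using opU by (intro open_vimage continuous_intros)
    then show ?thesis
      by (rule has_field_derivative_transform_within_open[OF D]) (use that density in auto)
  qed
  have cont_r': "continuous_on U (\<lambda>(t, x). r' t x)"
    unfolding r'_def split_beta prod.collapse
    using gram_pos
    by (intro continuous_intros continuous_on_gram continuous_on_gram_rate cont_M cont_P cont_M' cont_P') fastforce
  have rate0: "r' 0 x = area_density_rate G c (snd c \<circ> F \<circ> chart_inv k) (\<lambda>x. W (chart_inv k x) c) x"
    if x: "x \<in> K" for x
  proof -
    have z: "(0, x) \<in> U"
      by (rule 0[OF x])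
    define N where "N = (\<lambda>x. (0::real, x)) -` U"
    have N: "open N" "x \<in> N"
      unfolding N_def using opU z by (auto intro!: open_vimage continuous_intros)
    \<comment> \<open>The equality is needed on a neighbourhood of \<open>x\<close>, because it is
      going to be differentiated in space.\<close>
    have Q0: "Q (0, y) = W (chart_inv k y) c" if "y \<in> N" for y
    proof -
      have y: "(0, y) \<in> U"
        using that by (simp add: N_def)
      have "((\<lambda>s. \<phi> (s, y)) has_vector_derivative W (chart_inv k y) c) (at 0)"
        using vel[of "chart_inv k y"] y by (simp add: \<phi>_def U_def \<Phi>0)
      then show ?thesis
        using time[OF \<phi>diff[OF y]] unfolding Q_def by (metis vector_derivative_unique_at)
    qed
    have "P' i (0, x) = frechet_derivative (\<lambda>x. W (chart_inv k x) c) (at x) (axis i 1)" for i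
    proof -
      \<comment> \<open>The time derivative of the frame becomes a spatial derivative of the
        velocity.\<close>
      have "P' i (0, x) = frechet_derivative Q (at (0, x)) (0, axis i 1)"
        unfolding P'_def P_def[abs_def] Q_def[abs_def] by (rule mixed_derivative_swap[OF opU z Ck])
      moreover have Qd: "(Q has_derivative frechet_derivative Q (at (0, x))) (at (0, x))"
      proof -
        have "Q differentiable (at (0, x))"
          using Ck z unfolding Q_def[abs_def] by simp
        then show ?thesis
          by (simp only: frechet_derivative_works)
      qed
      from has_derivative_compose[where f = "\<lambda>x. (0, x)" and g = Q,
          OF has_derivative_Pair[OF has_derivative_const has_derivative_ident] Qd]
      have "((\<lambda>x. Q (0, x)) has_derivative (\<lambda>v. frechet_derivative Q (at (0, x)) (0, v))) (at x)" .
      then have "((\<lambda>x. W (chart_inv k x) c) has_derivative (\<lambda>v. frechet_derivative Q (at (0, x)) (0, v))) (at x)"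
        by (rule has_derivative_transform_within_open[OF _ N]) (simp add: Q0)
      ultimately show ?thesis
        using frechet_derivative_at by metis
    qed
    moreover have "frechet_derivative (snd c \<circ> F \<circ> chart_inv k) (at x) (axis i 1) = P i (0, x)" for i
      using P_eq[OF z] by (simp add: \<Phi>0)
    moreover have "\<phi> (0, x) = (snd c \<circ> F \<circ> chart_inv k) x"
      by (simp add: \<phi>_def \<Phi>0)
    ultimately show ?thesis
      unfolding r'_def area_density_rate_def Let_def M_def M'_def by (simp add: Q0[OF N(2)])
  qed
  \<comment> \<open>If \<open>K\<close> is empty, the tube says nothing about times;
    \<open>e / 2\<close> keeps them where \<open>\<Phi> t\<close> is known to be a surface.\<close>
  define d' where "d' = min d (e / 2)"
  show thesis
  proof (rule that)
    show "0 < d'"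
      using d(1) e by (simp add: d'_def)
    show "closed_spacelike_surface A G B (\<Phi> t)" if "\<bar>t\<bar> \<le> d'" for t
      using that e by (intro surf) (auto simp: d'_def)
    show "((\<lambda>s. area_density A G (\<Phi> s) k x) has_real_derivative r' t x) (at t)"
      if "\<bar>t\<bar> \<le> d'" "x \<in> K" for t x
      using that by (intro deriv d(2)) (auto simp: d'_def)
    show "continuous_on ({-d'..d'} \<times> K) (\<lambda>(t, x). r' t x)"
      by (rule continuous_on_subset[OF cont_r']) (auto intro!: d(2) simp: d'_def)
  qed (rule rate0)
qed

end

section \<open>From the pieces to the area\<close>

text \<open>The contribution of one piece. Finiteness is recorded because \<open>measure\<close>
  turns infinity into 0, so real values of the pieces can be added up safely only when they are
  finite.\<close>

lemma measure_variation:
  assumes A: "smooth_atlas A" and G: "lorentzian_metric A G" and F: "closed_spacelike_surface A G B F"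
    and \<Phi>: "variation A G B F W \<Phi>"
    and k: "k \<in> B" and c: "c \<in> A" and K: "compact K" "K \<subseteq> snd k ` (fst k \<inter> F -` fst c)"
    and E: "E \<in> sets borel" "E \<subseteq> fst k" "snd k ` E \<subseteq> K"
  shows "\<forall>\<^sub>F t in nhds 0. emeasure (area_measure A G B (\<Phi> t)) E \<noteq> \<infinity>"
    and "((\<lambda>t. measure (area_measure A G B (\<Phi> t)) E) has_real_derivative
      (LINT x:snd k ` E|lborel. area_density_rate G c (snd c \<circ> F \<circ> chart_inv k) (\<lambda>x. W (chart_inv k x) c) x)) (at 0)"
proof -
  obtain d r' where d: "0 < d"
    and surf: "\<And>t. \<bar>t\<bar> \<le> d \<Longrightarrow> closed_spacelike_surface A G B (\<Phi> t)"
    and r: "\<And>t x. \<bar>t\<bar> \<le> d \<Longrightarrow> x \<in> K \<Longrightarrow>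
      ((\<lambda>s. area_density A G (\<Phi> s) k x) has_real_derivative r' t x) (at t)"
    and cont': "continuous_on ({-d..d} \<times> K) (\<lambda>(t, x). r' t x)"
    and rate: "\<And>x. x \<in> K \<Longrightarrow> r' 0 x = area_density_rate G c (snd c \<circ> F \<circ> chart_inv k) (\<lambda>x. W (chart_inv k x) c) x"
    using area_density_variation[OF A G F \<Phi> k c K] by blast
  have B: "smooth_atlas B"
    by (rule surface_atlas[OF F])
  have Y: "snd k ` E \<in> sets borel"
    by (rule borel_chart_subset[OF B k E(1,2)])
  have K': "K \<subseteq> chart_image k"
    using K(2) by (auto simp: chart_image_def)
  have cont: "continuous_on K (area_density A G (\<Phi> t) k)" if "\<bar>t\<bar> \<le> d" for t
    using continuous_on_area_density[OF A G surf[OF that] k] K' by (rule continuous_on_subset)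
  note int = has_real_derivative_set_integral(1)[OF d K(1) Y E(3) r cont cont', simplified]
  note der = has_real_derivative_set_integral(2)[OF d K(1) Y E(3) r cont cont', simplified]
  have nonneg: "0 \<le> area_density A G (\<Phi> t) k x" if "\<bar>t\<bar> \<le> d" "x \<in> snd k ` E" for t x
    using area_density_pos[OF A G surf[OF that(1)] k, of x] that(2) E(3) K'
    by (meson less_imp_le subset_iff)
  have em: "emeasure (area_measure A G B (\<Phi> t)) E = ennreal (LINT x:snd k ` E|lborel. area_density A G (\<Phi> t) k x)"
    if t: "\<bar>t\<bar> \<le> d" for t
  proof -
    have "emeasure (area_measure A G B (\<Phi> t)) E = (\<integral>\<^sup>+x\<in>snd k ` E. ennreal (area_density A G (\<Phi> t) k x) \<partial>lborel)"
      using has_chart_densities_area_measure[OF A G surf[OF t]] k E unfolding has_chart_densities_def by blast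
    also have "\<dots> = (\<integral>\<^sup>+x. ennreal (indicator (snd k ` E) x *\<^sub>R area_density A G (\<Phi> t) k x) \<partial>lborel)"
      by (intro nn_integral_cong) (auto simp: indicator_def)
    also have "\<dots> = ennreal (LINT x:snd k ` E|lborel. area_density A G (\<Phi> t) k x)"
      unfolding set_lebesgue_integral_def
      using int[OF t] nonneg[OF t]
      by (intro nn_integral_eq_integral) (auto simp: set_integrable_def indicator_def)
    finally show ?thesis .
  qed
  have ev: "\<forall>\<^sub>F t in nhds 0. \<bar>t\<bar> \<le> d"
    unfolding eventually_nhds_metric using d by (auto intro!: exI[of _ d])
  then show "\<forall>\<^sub>F t in nhds 0. emeasure (area_measure A G B (\<Phi> t)) E \<noteq> \<infinity>"
    by eventually_elim (simp add: em)
  have "measure (area_measure A G B (\<Phi> t)) E = (LINT x:snd k ` E|lborel. area_density A G (\<Phi> t) k x)"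
    if t: "\<bar>t\<bar> \<le> d" for t
  proof -
    have "0 \<le> (LINT x:snd k ` E|lborel. area_density A G (\<Phi> t) k x)"
      unfolding set_lebesgue_integral_def using nonneg[OF t]
      by (intro Bochner_Integration.integral_nonneg) (auto simp: indicator_def)
    then show ?thesis
      unfolding measure_def em[OF t] by simp
  qed
  with ev have "\<forall>\<^sub>F t in nhds 0. measure (area_measure A G B (\<Phi> t)) E
      = (LINT x:snd k ` E|lborel. area_density A G (\<Phi> t) k x)"
    by (auto elim: eventually_mono)
  moreover have "(LINT x:snd k ` E|lborel. r' 0 x) =
      (LINT x:snd k ` E|lborel. area_density_rate G c (snd c \<circ> F \<circ> chart_inv k) (\<lambda>x. W (chart_inv k x) c) x)"
    using Y E(3) by (intro set_lebesgue_integral_cong) (auto intro!: rate)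
  ultimately show "((\<lambda>t. measure (area_measure A G B (\<Phi> t)) E) has_real_derivative
      (LINT x:snd k ` E|lborel. area_density_rate G c (snd c \<circ> F \<circ> chart_inv k) (\<lambda>x. W (chart_inv k x) c) x)) (at 0)"
    using der by (simp add: DERIV_cong_ev[OF refl])
qed

text \<open>The pieces and their rates are determined before \<open>\<Phi>\<close> enters, hence one
  \<open>a\<close> for all variations. Positivity of the real number \<open>area\<close> requires a
  finite measure too, and finiteness comes from the same pieces.\<close>

lemma area_first_variation:
  fixes A :: "('m::{t2_space, second_countable_topology}, real^4) chart set"
    and B :: "('s::{t2_space, second_countable_topology}, real^2) chart set"
  assumes A: "smooth_atlas A" and G: "lorentzian_metric A G" and F: "closed_spacelike_surface A G B F"
  shows "\<exists>a. has_first_variation A G B F W (area A G B) a"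
    and "variation A G B F W \<Phi> \<Longrightarrow> \<forall>\<^sub>F t in nhds 0. 0 < area A G B (\<Phi> t)"
proof -
  have B: "smooth_atlas B"
    by (rule surface_atlas[OF F])
  define k where "k p = chart_at B p" for p
  define c where "c p = chart_at A (F p)" for p
  have k: "k p \<in> B" "p \<in> fst (k p)" and c: "c p \<in> A" "F p \<in> fst (c p)" for p
    unfolding k_def c_def using chart_at_mem[OF B] chart_at_mem[OF A] by auto
  have "\<exists>r>0. cball (snd (k p) p) r \<subseteq> snd (k p) ` (fst (k p) \<inter> F -` fst (c p))" for p
  proof -
    have "snd (k p) p \<in> snd (k p) ` (fst (k p) \<inter> F -` fst (c p))"
      using k c by auto
    then show ?thesis
      using open_chart_preimage[OF A G F k(1) c(1)] open_contains_cball by blast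
  qed
  then obtain r where r: "\<And>p. 0 < r p"
    "\<And>p. cball (snd (k p) p) (r p) \<subseteq> snd (k p) ` (fst (k p) \<inter> F -` fst (c p))"
    by metis
  \<comment> \<open>Open balls make the sets \<open>U p\<close> an open cover; the closed balls are
    the compact sets that \<open>measure_variation\<close> asks for.\<close>
  define U where "U p = fst (k p) \<inter> snd (k p) -` ball (snd (k p) p) (r p)" for p
  have "open (U p)" for p
    unfolding U_def using continuous_on_chart[OF B k(1)] open_chart_domain[OF B k(1)]
    by (metis continuous_on_open_vimage inf_commute open_ball)
  moreover have "p \<in> U p" for p
    using k r by (simp add: U_def)
  ultimately obtain P E where P: "finite P" "\<And>p. p \<in> P \<Longrightarrow> E p \<in> sets borel" "\<And>p. p \<in> P \<Longrightarrow> E p \<subseteq> U p"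
    "disjoint_family_on E P" "(\<Union>p\<in>P. E p) = UNIV"
    using finite_borel_partition[OF compact_surface[OF F]] by metis
  have E: "E p \<subseteq> fst (k p)" "snd (k p) ` E p \<subseteq> cball (snd (k p) p) (r p)" if "p \<in> P" for p
    using P(3)[OF that] by (auto simp: U_def)
  define a where "a = (\<Sum>p\<in>P. LINT x:snd (k p) ` E p|lborel.
    area_density_rate G (c p) (snd (c p) \<circ> F \<circ> chart_inv (k p)) (\<lambda>x. W (chart_inv (k p) x) (c p)) x)"
  have *: "((\<lambda>t. area A G B (\<Phi> t)) has_real_derivative a) (at 0) \<and> (\<forall>\<^sub>F t in nhds 0. 0 < area A G B (\<Phi> t))"
    if \<Phi>: "variation A G B F W \<Phi>" for \<Phi>
  proof -
    note piece = measure_variation[OF A G F \<Phi> k(1) c(1) compact_cball r(2) P(2) E]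
    have "\<forall>\<^sub>F t in nhds 0. \<forall>p\<in>P. emeasure (area_measure A G B (\<Phi> t)) (E p) \<noteq> \<infinity>"
      using P(1) piece(1) by (simp add: eventually_ball_finite_distrib)
    moreover have "\<forall>\<^sub>F t in nhds 0. closed_spacelike_surface A G B (\<Phi> t)"
    proof -
      obtain e where "0 < e" "\<forall>t\<in>{-e<..<e}. closed_spacelike_surface A G B (\<Phi> t)"
        using \<Phi> unfolding variation_def by blast
      then show ?thesis
        unfolding eventually_nhds_metric by (auto intro!: exI[of _ e] simp: abs_less_iff)
    qed
    ultimately have ev: "\<forall>\<^sub>F t in nhds 0. 0 < area A G B (\<Phi> t) \<and>
        area A G B (\<Phi> t) = (\<Sum>p\<in>P. measure (area_measure A G B (\<Phi> t)) (E p))"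
    proof eventually_elim
      case (elim t)
      define \<mu> where "\<mu> = area_measure A G B (\<Phi> t)"
      have \<mu>: "has_chart_densities B (area_density A G (\<Phi> t)) \<mu>"
        unfolding \<mu>_def by (rule has_chart_densities_area_measure[OF A G elim(2)])
      then have sets: "E ` P \<subseteq> sets \<mu>"
        using P(2) by (auto simp: has_chart_densities_def)
      have fin: "emeasure \<mu> (E p) \<noteq> \<infinity>" if "p \<in> P" for p
        using elim(1) that by (simp add: \<mu>_def)
      have "emeasure \<mu> UNIV = (\<Sum>p\<in>P. emeasure \<mu> (E p))"
        using sum_emeasure[OF sets P(4,1)] P(5) by simp
      then have "emeasure \<mu> UNIV < \<infinity>"
        using fin by (auto simp: ennreal_sum_less_top P(1) less_top)
      moreover have "0 < emeasure \<mu> UNIV"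
        by (rule emeasure_chart_densities_pos[OF B density_family_area_density[OF A G elim(2)] \<mu>])
      ultimately have "0 < measure \<mu> UNIV"
        by (simp add: measure_def enn2real_positive_iff)
      moreover have "measure \<mu> UNIV = (\<Sum>p\<in>P. measure \<mu> (E p))"
        using measure_finite_Union[OF P(1) sets P(4) fin] P(5) by simp
      ultimately show ?case
        by (simp add: area_def \<mu>_def)
    qed
    have "((\<lambda>t. \<Sum>p\<in>P. measure (area_measure A G B (\<Phi> t)) (E p)) has_real_derivative a) (at 0)"
      unfolding a_def by (rule DERIV_sum) (rule piece(2))
    moreover have "\<forall>\<^sub>F t in nhds 0. area A G B (\<Phi> t) = (\<Sum>p\<in>P. measure (area_measure A G B (\<Phi> t)) (E p))"
      using ev by (rule eventually_mono) simp
    ultimately have "((\<lambda>t. area A G B (\<Phi> t)) has_real_derivative a) (at 0)"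
      by (simp add: DERIV_cong_ev[OF refl])
    then show ?thesis
      using ev by (auto elim: eventually_mono)
  qed
  show "\<exists>a. has_first_variation A G B F W (area A G B) a"
    using * unfolding has_first_variation_def by blast
  show "variation A G B F W \<Phi> \<Longrightarrow> \<forall>\<^sub>F t in nhds 0. 0 < area A G B (\<Phi> t)"
    using * by blast
qed

section \<open>From the area to the Hawking energy\<close>

text \<open>The product rule for \<open>s * (1 - w / (16 * pi))\<close> with
  \<open>s' = m' / (32 * pi * s)\<close> gives derivative 0 exactly for
  \<open>w' = e * m' / (2 * s^3)\<close>. Differentiability of \<open>w\<close> is not presupposed:
  in one direction it has to be deduced from that of \<open>e\<close>.\<close>

lemma hawking_derivative_iff:
  fixes m w :: "real \<Rightarrow> real"
  assumes m: "(m has_real_derivative m') (at 0)" and pos: "\<forall>\<^sub>F t in nhds 0. 0 < m t"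
  defines "e \<equiv> \<lambda>t. sqrt (m t / (16 * pi)) * (1 - 1 / (16 * pi) * w t)"
  shows "(e has_real_derivative 0) (at 0) \<longleftrightarrow>
    (w has_real_derivative 4 * e 0 / sqrt (m 0 / (4 * pi)) ^ 3 * m') (at 0)"
proof -
  define s where "s t = sqrt (m t / (16 * pi))" for t
  have m0: "0 < m 0"
    using eventually_nhds_x_imp_x[OF pos] .
  then have s0: "0 < s 0"
    by (simp add: s_def)
  have s: "(s has_real_derivative m' / (16 * pi) / (2 * s 0)) (at 0)"
    using DERIV_chain2[OF DERIV_real_sqrt DERIV_cdivide[OF m, of "16 * pi"]] m0
    by (simp add: s_def[abs_def] field_simps)
  have "m 0 / (4 * pi) = 2\<^sup>2 * (m 0 / (16 * pi))"
    by simp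
  then have "sqrt (m 0 / (4 * pi)) = 2 * s 0"
    unfolding s_def by (simp only: real_sqrt_mult real_sqrt_abs abs_numeral)
  then have l: "4 * e 0 / sqrt (m 0 / (4 * pi)) ^ 3 * m' = e 0 * m' / (2 * s 0 ^ 3)"
    by (simp add: power3_eq_cube)
  have e: "e t = s t * (1 - 1 / (16 * pi) * w t)" for t
    by (simp add: e_def s_def)
  \<comment> \<open>Solving for \<open>w\<close> divides by \<open>s\<close>, which positivity
    allows near 0; this exhibits \<open>w\<close> as a differentiable function of \<open>e\<close>
    and \<open>s\<close>.\<close>
  have ev: "\<forall>\<^sub>F t in nhds 0. w t = 16 * pi * (1 - e t / s t)"
    using pos by eventually_elim (simp add: e s_def)
  show ?thesis
    unfolding l
  proof
    assume "(e has_real_derivative 0) (at 0)"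
    from DERIV_cmult[OF DERIV_diff[OF DERIV_const DERIV_divide[OF this s]], of "16 * pi" 1]
    have "((\<lambda>t. 16 * pi * (1 - e t / s t)) has_real_derivative e 0 * m' / (2 * s 0 ^ 3)) (at 0)"
      using s0 by (simp add: field_simps power3_eq_cube)
    then show "(w has_real_derivative e 0 * m' / (2 * s 0 ^ 3)) (at 0)"
      using ev by (simp add: DERIV_cong_ev[OF refl])
  next
    assume "(w has_real_derivative e 0 * m' / (2 * s 0 ^ 3)) (at 0)"
    then have "((\<lambda>t. s t * (1 - 1 / (16 * pi) * w t)) has_real_derivative
        m' / (16 * pi) / (2 * s 0) * (1 - 1 / (16 * pi) * w 0)
        + s 0 * - (1 / (16 * pi) * (e 0 * m' / (2 * s 0 ^ 3)))) (at 0)"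
      by (auto intro!: derivative_eq_intros s)
    moreover have "m' / (16 * pi) / (2 * s 0) * (1 - 1 / (16 * pi) * w 0)
        + s 0 * - (1 / (16 * pi) * (e 0 * m' / (2 * s 0 ^ 3))) = 0"
      unfolding e using s0 by (simp add: divide_simps power3_eq_cube)
    ultimately show "(e has_real_derivative 0) (at 0)"
      unfolding e[abs_def] by simp
  qed
qed

theorem proposition4p2:
  fixes A :: "('m::{t2_space, second_countable_topology}, real^4) chart set"
    and G :: "'m metric"
    and T :: "'m \<Rightarrow> ('m, real^4) tvec"
    and B :: "('s::{t2_space, second_countable_topology}, real^2) chart set"
    and F :: "'s \<Rightarrow> 'm"
    and V :: "'s \<Rightarrow> ('m, real^4) tvec"
  assumes "smooth_atlas A"
    and "lorentzian_metric A G"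
    and "time_orientation A G T"
    and "closed_spacelike_surface A G B F"
    and "smooth_normal_direction A G B F V"
  shows "(\<forall>\<alpha>. smooth_scalar B \<alpha> \<longrightarrow>
            has_first_variation A G B F (scale_field \<alpha> V) (hawking_energy A G B) 0) \<longleftrightarrow>
         area_constrained_willmore_with_multiplier A G B F V
           (4 * hawking_energy A G B F / area_radius A G B F ^ 3)"
proof -
  note surface = assms(1,2,4)
  define l where "l = 4 * hawking_energy A G B F / area_radius A G B F ^ 3"
  \<comment> \<open>The equivalence holds for each variation by itself. Its multiplier involves only
    values at time 0, where \<open>\<Phi> 0 = F\<close>, so \<open>l * a\<close> is the same for all
    of them.\<close>
  have iff: "has_first_variation A G B F W (hawking_energy A G B) 0 \<longleftrightarrow>
      has_first_variation A G B F W (willmore A G B) (l * a)"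
    if a: "has_first_variation A G B F W (area A G B) a" for W a
  proof -
    have "((\<lambda>t. hawking_energy A G B (\<Phi> t)) has_real_derivative 0) (at 0) \<longleftrightarrow>
        ((\<lambda>t. willmore A G B (\<Phi> t)) has_real_derivative l * a) (at 0)"
      if \<Phi>: "variation A G B F W \<Phi>" for \<Phi>
    proof -
      have "((\<lambda>t. area A G B (\<Phi> t)) has_real_derivative a) (at 0)"
        using a \<Phi> by (simp add: has_first_variation_def)
      moreover have "\<Phi> 0 = F"
        using \<Phi> by (simp add: variation_def)
      ultimately show ?thesis
        using hawking_derivative_iff[OF _ area_first_variation(2)[OF surface \<Phi>], of a "\<lambda>t. willmore A G B (\<Phi> t)"]
        by (simp add: hawking_energy_def l_def area_radius_def)
    qed
    then show ?thesis
      unfolding has_first_variation_def by blast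
  qed
  \<comment> \<open>Forwards, \<open>a\<close> comes from \<open>area_first_variation\<close> and
    \<open>l * a\<close> is the witness for \<open>w\<close>; backwards, the definition itself
    supplies \<open>a\<close>.\<close>
  show ?thesis
    unfolding area_constrained_willmore_with_multiplier_def l_def[symmetric]
    using iff area_first_variation(1)[OF surface] by metis
qed

end
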